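(* Let $k$ be a field. Suppose $\mathcal{C}$ is a $\operatorname{Hom}$-finite, Krull-Schmidt, triangulated $k$-category that has Serre duality, and assume $R$ is a rigid object of $\mathcal{C}$. Then the additive quotient category $\mathcal{C}/[\mathcal{X}_{R}]$ is quasi-abelian.
   Context: $\Sigma$ is the suspension functor of $\mathcal{C}$ and $\operatorname{Ext}^{1}_{\mathcal{C}}(X,Y)=\operatorname{Hom}_{\mathcal{C}}(X,\Sigma Y)$. An object $R$ is rigid if $\operatorname{Ext}^{1}_{\mathcal{C}}(R,R)=0$. $\mathcal{X}_{R}$ is the full subcategory of objects $Y$ of $\mathcal{C}$ with $\operatorname{Hom}_{\mathcal{C}}(R,Y)=0$, and $[\mathcal{X}_{R}]$ is the ideal of morphisms of $\mathcal{C}$ factoring through an object of $\mathcal{X}_{R}$. $\mathcal{C}$ is $\operatorname{Hom}$-finite if all its $\operatorname{Hom}$-spaces are finite-dimensional over $k$. $\mathcal{C}$ has Serre duality if it has a Serre functor: a triangle autoequivalence $\nu\colon\mathcal{C}\to\mathcal{C}$ with isomorphisms $\operatorname{Hom}_{\mathcal{C}}(X,Y)\cong D\operatorname{Hom}_{\mathcal{C}}(Y,\nu X)$ functorial in both $X$ and $Y$, where $D=\operatorname{Hom}_{k}(-,k)$. A preabelian category is an additive category in which every morphism has a kernel and a cokernel. A preabelian category is quasi-abelian if cokernels (morphisms that are a cokernel of some morphism) are stable under pullback and kernels (morphisms that are a kernel of some morphism) are stable under pushout. *)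

theory Defs
  imports "Jordan_Normal_Form.Missing_VectorSpace"
begin

section \<open>Categories and functors\<close>

text \<open>Composition is written in the usual order: \<open>g \<cdot> f\<close> is first \<open>f\<close>, then \<open>g\<close>.\<close>

record ('o, 'm) cat =
  Obj :: "'o set"
  Hom :: "'o \<Rightarrow> 'o \<Rightarrow> 'm set"
  Comp :: "'m \<Rightarrow> 'm \<Rightarrow> 'm" (infixr "\<cdot>\<index>" 70)
  Ident :: "'o \<Rightarrow> 'm"

text \<open>As usual, distinct \<open>Hom\<close>-sets are disjoint, so a morphism determines its source and target.
  Outside of \<open>Obj C\<close> the \<open>Hom\<close>-sets are empty.\<close>

locale category =
  fixes C :: "('o, 'm, 'z) cat_scheme" (structure)
  assumes Hom_Obj: "f \<in> Hom C X Y \<Longrightarrow> X \<in> Obj C \<and> Y \<in> Obj C"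
    and Hom_disjoint: "\<lbrakk>f \<in> Hom C X Y; f \<in> Hom C X' Y'\<rbrakk> \<Longrightarrow> X = X' \<and> Y = Y'"
    and Comp_closed: "\<lbrakk>f \<in> Hom C X Y; g \<in> Hom C Y Z\<rbrakk> \<Longrightarrow> g \<cdot> f \<in> Hom C X Z"
    and Comp_assoc: "\<lbrakk>f \<in> Hom C W X; g \<in> Hom C X Y; h \<in> Hom C Y Z\<rbrakk>
      \<Longrightarrow> (h \<cdot> g) \<cdot> f = h \<cdot> (g \<cdot> f)"
    and Ident_closed: "X \<in> Obj C \<Longrightarrow> Ident C X \<in> Hom C X X"
    and Comp_Ident: "f \<in> Hom C X Y \<Longrightarrow> f \<cdot> Ident C X = f"
    and Ident_Comp: "f \<in> Hom C X Y \<Longrightarrow> Ident C Y \<cdot> f = f"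

definition is_iso :: "('o, 'm, 'z) cat_scheme \<Rightarrow> 'm \<Rightarrow> bool" where
  "is_iso C f \<longleftrightarrow> (\<exists>X Y g. f \<in> Hom C X Y \<and> g \<in> Hom C Y X \<and>
     g \<cdot>\<^bsub>C\<^esub> f = Ident C X \<and> f \<cdot>\<^bsub>C\<^esub> g = Ident C Y)"

definition is_pullback ::
  "('o, 'm, 'z) cat_scheme \<Rightarrow> 'm \<Rightarrow> 'm \<Rightarrow> 'm \<Rightarrow> 'm \<Rightarrow> bool" where
  "is_pullback C f g p q \<longleftrightarrow> (\<exists>P X Y Z.
     f \<in> Hom C X Z \<and> g \<in> Hom C Y Z \<and> p \<in> Hom C P X \<and> q \<in> Hom C P Y \<and>
     f \<cdot>\<^bsub>C\<^esub> p = g \<cdot>\<^bsub>C\<^esub> q \<and>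
     (\<forall>W. \<forall>a \<in> Hom C W X. \<forall>b \<in> Hom C W Y. f \<cdot>\<^bsub>C\<^esub> a = g \<cdot>\<^bsub>C\<^esub> b \<longrightarrow>
       (\<exists>!h. h \<in> Hom C W P \<and> p \<cdot>\<^bsub>C\<^esub> h = a \<and> q \<cdot>\<^bsub>C\<^esub> h = b)))"

definition is_pushout ::
  "('o, 'm, 'z) cat_scheme \<Rightarrow> 'm \<Rightarrow> 'm \<Rightarrow> 'm \<Rightarrow> 'm \<Rightarrow> bool" where
  "is_pushout C f g i j \<longleftrightarrow> (\<exists>X Y Z P.
     f \<in> Hom C X Y \<and> g \<in> Hom C X Z \<and> i \<in> Hom C Y P \<and> j \<in> Hom C Z P \<and>
     i \<cdot>\<^bsub>C\<^esub> f = j \<cdot>\<^bsub>C\<^esub> g \<and>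
     (\<forall>W. \<forall>a \<in> Hom C Y W. \<forall>b \<in> Hom C Z W. a \<cdot>\<^bsub>C\<^esub> f = b \<cdot>\<^bsub>C\<^esub> g \<longrightarrow>
       (\<exists>!h. h \<in> Hom C P W \<and> h \<cdot>\<^bsub>C\<^esub> i = a \<and> h \<cdot>\<^bsub>C\<^esub> j = b)))"

record ('o, 'm, 'p, 'n) fctr =
  omap :: "'o \<Rightarrow> 'p"
  amap :: "'m \<Rightarrow> 'n"

definition id_fctr :: "('o, 'm, 'o, 'm) fctr" where
  "id_fctr = \<lparr>omap = (\<lambda>X. X), amap = (\<lambda>f. f)\<rparr>"

definition comp_fctr ::
  "('p, 'n, 'q, 'l) fctr \<Rightarrow> ('o, 'm, 'p, 'n) fctr \<Rightarrow> ('o, 'm, 'q, 'l) fctr" where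
  "comp_fctr G F = \<lparr>omap = omap G \<circ> omap F, amap = amap G \<circ> amap F\<rparr>"

definition is_functor ::
  "('o, 'm, 'y) cat_scheme \<Rightarrow> ('p, 'n, 'z) cat_scheme \<Rightarrow> ('o, 'm, 'p, 'n) fctr \<Rightarrow> bool" where
  "is_functor C D F \<longleftrightarrow>
     (\<forall>X \<in> Obj C. omap F X \<in> Obj D) \<and>
     (\<forall>X Y. \<forall>f \<in> Hom C X Y. amap F f \<in> Hom D (omap F X) (omap F Y)) \<and>
     (\<forall>X \<in> Obj C. amap F (Ident C X) = Ident D (omap F X)) \<and>
     (\<forall>X Y Z. \<forall>f \<in> Hom C X Y. \<forall>g \<in> Hom C Y Z.
       amap F (g \<cdot>\<^bsub>C\<^esub> f) = amap F g \<cdot>\<^bsub>D\<^esub> amap F f)"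

definition natural_iso ::
  "('o, 'm, 'y) cat_scheme \<Rightarrow> ('p, 'n, 'z) cat_scheme \<Rightarrow>
   ('o, 'm, 'p, 'n) fctr \<Rightarrow> ('o, 'm, 'p, 'n) fctr \<Rightarrow> ('o \<Rightarrow> 'n) \<Rightarrow> bool" where
  "natural_iso C D F G \<eta> \<longleftrightarrow>
     (\<forall>X \<in> Obj C. \<eta> X \<in> Hom D (omap F X) (omap G X) \<and> is_iso D (\<eta> X)) \<and>
     (\<forall>X Y. \<forall>f \<in> Hom C X Y. \<eta> Y \<cdot>\<^bsub>D\<^esub> amap F f = amap G f \<cdot>\<^bsub>D\<^esub> \<eta> X)"

definition is_equivalence ::
  "('o, 'm, 'y) cat_scheme \<Rightarrow> ('p, 'n, 'z) cat_scheme \<Rightarrow> ('o, 'm, 'p, 'n) fctr \<Rightarrow> bool" where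
  "is_equivalence C D F \<longleftrightarrow> is_functor C D F \<and>
     (\<exists>G \<eta> \<epsilon>. is_functor D C G \<and>
       natural_iso C C id_fctr (comp_fctr G F) \<eta> \<and>
       natural_iso D D (comp_fctr F G) id_fctr \<epsilon>)"

section \<open>Additive categories\<close>

record ('o, 'm) addcat = "('o, 'm) cat" +
  Add :: "'m \<Rightarrow> 'm \<Rightarrow> 'm" (infixl "\<boxplus>\<index>" 65)
  Zero :: "'o \<Rightarrow> 'o \<Rightarrow> 'm"

text \<open>The \<open>Hom\<close>-group from \<open>X\<close> to \<open>Y\<close>. For \<open>X = Y\<close> this is the endomorphism ring of \<open>X\<close>;
  for \<open>X \<noteq> Y\<close> the fields \<open>mult\<close> and \<open>one\<close> carry no meaning.\<close>

definition hom_group :: "('o, 'm, 'z) addcat_scheme \<Rightarrow> 'o \<Rightarrow> 'o \<Rightarrow> 'm ring" where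
  "hom_group C X Y = \<lparr>carrier = Hom C X Y, monoid.mult = Comp C, one = Ident C X,
     zero = Zero C X Y, add = Add C\<rparr>"

locale preadditive_category = category C for C :: "('o, 'm, 'z) addcat_scheme" (structure) +
  assumes hom_abelian_group:
      "\<lbrakk>X \<in> Obj C; Y \<in> Obj C\<rbrakk> \<Longrightarrow> abelian_group (hom_group C X Y)"
    and Comp_Add_left: "\<lbrakk>f \<in> Hom C X Y; g \<in> Hom C Y Z; g' \<in> Hom C Y Z\<rbrakk>
      \<Longrightarrow> (g \<boxplus> g') \<cdot> f = (g \<cdot> f) \<boxplus> (g' \<cdot> f)"
    and Comp_Add_right: "\<lbrakk>f \<in> Hom C X Y; f' \<in> Hom C X Y; g \<in> Hom C Y Z\<rbrakk>
      \<Longrightarrow> g \<cdot> (f \<boxplus> f') = (g \<cdot> f) \<boxplus> (g \<cdot> f')"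

text \<open>\<open>S\<close> is the direct sum of \<open>X 0, \<dots>, X (n - 1)\<close> with inclusions \<open>i\<close> and projections \<open>p\<close>.
  For \<open>n = 0\<close> this says that the identity of \<open>S\<close> is zero, i.e. that \<open>S\<close> is a zero object.\<close>

definition is_direct_sum ::
  "('o, 'm, 'z) addcat_scheme \<Rightarrow> nat \<Rightarrow> (nat \<Rightarrow> 'o) \<Rightarrow> 'o \<Rightarrow> (nat \<Rightarrow> 'm) \<Rightarrow> (nat \<Rightarrow> 'm) \<Rightarrow> bool"
where
  "is_direct_sum C n X S i p \<longleftrightarrow> S \<in> Obj C \<and>
     (\<forall>j<n. X j \<in> Obj C \<and> i j \<in> Hom C (X j) S \<and> p j \<in> Hom C S (X j)) \<and>
     (\<forall>j<n. \<forall>l<n. p l \<cdot>\<^bsub>C\<^esub> i j = (if j = l then Ident C (X j) else Zero C (X j) (X l))) \<and>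
     (\<Oplus>\<^bsub>hom_group C S S\<^esub>j\<in>{..<n}. i j \<cdot>\<^bsub>C\<^esub> p j) = Ident C S"

locale additive_category = preadditive_category +
  assumes direct_sums: "(\<And>j. j < n \<Longrightarrow> X j \<in> Obj C) \<Longrightarrow> \<exists>S i p. is_direct_sum C n X S i p"

definition zero_object :: "('o, 'm, 'z) addcat_scheme \<Rightarrow> 'o \<Rightarrow> bool" where
  "zero_object C Z \<longleftrightarrow> Z \<in> Obj C \<and>
     (\<forall>X \<in> Obj C. Hom C X Z = {Zero C X Z} \<and> Hom C Z X = {Zero C Z X})"

definition additive_functor ::
  "('o, 'm, 'y) addcat_scheme \<Rightarrow> ('p, 'n, 'z) addcat_scheme \<Rightarrow> ('o, 'm, 'p, 'n) fctr \<Rightarrow> bool"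
where
  "additive_functor C D F \<longleftrightarrow> is_functor C D F \<and>
     (\<forall>X Y. \<forall>f \<in> Hom C X Y. \<forall>g \<in> Hom C X Y.
       amap F (f \<boxplus>\<^bsub>C\<^esub> g) = amap F f \<boxplus>\<^bsub>D\<^esub> amap F g)"

subsection \<open>Krull-Schmidt categories\<close>

definition local_ring :: "('a, 'z) ring_scheme \<Rightarrow> bool" where
  "local_ring E \<longleftrightarrow> ring E \<and> \<one>\<^bsub>E\<^esub> \<noteq> \<zero>\<^bsub>E\<^esub> \<and>
     (\<forall>a \<in> carrier E - Units E. \<forall>b \<in> carrier E - Units E. a \<oplus>\<^bsub>E\<^esub> b \<notin> Units E)"

definition krull_schmidt :: "('o, 'm, 'z) addcat_scheme \<Rightarrow> bool" where
  "krull_schmidt C \<longleftrightarrow> (\<forall>S \<in> Obj C. \<exists>n X i p. is_direct_sum C n X S i p \<and>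
     (\<forall>j<n. local_ring (hom_group C (X j) (X j))))"

subsection \<open>Quasi-abelian categories\<close>

definition is_kernel :: "('o, 'm, 'z) addcat_scheme \<Rightarrow> 'm \<Rightarrow> 'm \<Rightarrow> bool" where
  "is_kernel C f k \<longleftrightarrow> (\<exists>K X Y. f \<in> Hom C X Y \<and> k \<in> Hom C K X \<and> f \<cdot>\<^bsub>C\<^esub> k = Zero C K Y \<and>
     (\<forall>W. \<forall>g \<in> Hom C W X. f \<cdot>\<^bsub>C\<^esub> g = Zero C W Y \<longrightarrow>
       (\<exists>!h. h \<in> Hom C W K \<and> k \<cdot>\<^bsub>C\<^esub> h = g)))"

definition is_cokernel :: "('o, 'm, 'z) addcat_scheme \<Rightarrow> 'm \<Rightarrow> 'm \<Rightarrow> bool" where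
  "is_cokernel C f c \<longleftrightarrow> (\<exists>X Y Q. f \<in> Hom C X Y \<and> c \<in> Hom C Y Q \<and> c \<cdot>\<^bsub>C\<^esub> f = Zero C X Q \<and>
     (\<forall>W. \<forall>g \<in> Hom C Y W. g \<cdot>\<^bsub>C\<^esub> f = Zero C X W \<longrightarrow>
       (\<exists>!h. h \<in> Hom C Q W \<and> h \<cdot>\<^bsub>C\<^esub> c = g)))"

locale preabelian_category = additive_category +
  assumes kernels: "f \<in> Hom C X Y \<Longrightarrow> \<exists>k. is_kernel C f k"
    and cokernels: "f \<in> Hom C X Y \<Longrightarrow> \<exists>c. is_cokernel C f c"

locale quasi_abelian_category = preabelian_category +
  assumes cokernels_stable:
      "\<lbrakk>is_pullback C f g p q; \<exists>h. is_cokernel C h f\<rbrakk> \<Longrightarrow> \<exists>h. is_cokernel C h q"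
    and kernels_stable:
      "\<lbrakk>is_pushout C f g i j; \<exists>h. is_kernel C h f\<rbrakk> \<Longrightarrow> \<exists>h. is_kernel C h j"

subsection \<open>Additive quotients\<close>

text \<open>The morphisms from \<open>X\<close> to \<open>Y\<close> that factor through an object of the full subcategory of \<open>C\<close>
  on the set of objects \<open>S\<close>.\<close>

definition factoring :: "('o, 'm, 'z) addcat_scheme \<Rightarrow> 'o set \<Rightarrow> 'o \<Rightarrow> 'o \<Rightarrow> 'm set" where
  "factoring C S X Y = {b \<cdot>\<^bsub>C\<^esub> a | a b. \<exists>Z \<in> S. a \<in> Hom C X Z \<and> b \<in> Hom C Z Y}"

definition factoring_rel :: "('o, 'm, 'z) addcat_scheme \<Rightarrow> 'o set \<Rightarrow> ('m \<times> 'm) set" where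
  "factoring_rel C S = {(f, g). \<exists>X Y. f \<in> Hom C X Y \<and> g \<in> Hom C X Y \<and>
     f \<ominus>\<^bsub>hom_group C X Y\<^esub> g \<in> factoring C S X Y}"

text \<open>The quotient of \<open>C\<close> by the ideal of morphisms factoring through an object of \<open>S\<close>. That the
  \<^const>\<open>factoring\<close> morphisms form an ideal requires \<open>S\<close> to be closed under finite direct sums.\<close>

definition quotient_category ::
  "('o, 'm, 'z) addcat_scheme \<Rightarrow> 'o set \<Rightarrow> ('o, 'm set) addcat" where
  "quotient_category C S = (let r = factoring_rel C S in
     \<lparr>Obj = Obj C,
      Hom = (\<lambda>X Y. Hom C X Y // r),
      Comp = (\<lambda>B A. \<Union>b \<in> B. \<Union>a \<in> A. r `` {b \<cdot>\<^bsub>C\<^esub> a}),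
      Ident = (\<lambda>X. r `` {Ident C X}),
      Add = (\<lambda>A B. \<Union>a \<in> A. \<Union>b \<in> B. r `` {a \<boxplus>\<^bsub>C\<^esub> b}),
      Zero = (\<lambda>X Y. r `` {Zero C X Y})\<rparr>)"

section \<open>Linear categories\<close>

record ('o, 'm, 'k) lincat = "('o, 'm) addcat" +
  Scale :: "'k \<Rightarrow> 'm \<Rightarrow> 'm"

definition hom_module :: "('o, 'm, 'k, 'z) lincat_scheme \<Rightarrow> 'o \<Rightarrow> 'o \<Rightarrow> ('k, 'm) module" where
  "hom_module C X Y = \<lparr>carrier = Hom C X Y, monoid.mult = Comp C, one = Ident C X,
     zero = Zero C X Y, add = Add C, smult = Scale C\<rparr>"

locale linear_category = additive_category C
  for K :: "('k, 'r) ring_scheme" and C :: "('o, 'm, 'k, 'z) lincat_scheme" (structure) +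
  assumes hom_vectorspace:
      "\<lbrakk>X \<in> Obj C; Y \<in> Obj C\<rbrakk> \<Longrightarrow> vectorspace K (hom_module C X Y)"
    and Comp_Scale_left: "\<lbrakk>c \<in> carrier K; f \<in> Hom C X Y; g \<in> Hom C Y Z\<rbrakk>
      \<Longrightarrow> Scale C c g \<cdot> f = Scale C c (g \<cdot> f)"
    and Comp_Scale_right: "\<lbrakk>c \<in> carrier K; f \<in> Hom C X Y; g \<in> Hom C Y Z\<rbrakk>
      \<Longrightarrow> g \<cdot> Scale C c f = Scale C c (g \<cdot> f)"

definition linear_functor ::
  "('k, 'r) ring_scheme \<Rightarrow> ('o, 'm, 'k, 'y) lincat_scheme \<Rightarrow> ('p, 'n, 'k, 'z) lincat_scheme \<Rightarrow>
   ('o, 'm, 'p, 'n) fctr \<Rightarrow> bool" where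
  "linear_functor K C D F \<longleftrightarrow> additive_functor C D F \<and>
     (\<forall>c \<in> carrier K. \<forall>X Y. \<forall>f \<in> Hom C X Y. amap F (Scale C c f) = Scale D c (amap F f))"

definition hom_finite ::
  "('k, 'r) ring_scheme \<Rightarrow> ('o, 'm, 'k, 'z) lincat_scheme \<Rightarrow> bool" where
  "hom_finite K C \<longleftrightarrow> (\<forall>X \<in> Obj C. \<forall>Y \<in> Obj C. vectorspace.fin_dim K (hom_module C X Y))"

section \<open>Triangulated categories\<close>

text \<open>A triangle \<open>X \<rightarrow> Y \<rightarrow> Z \<rightarrow> \<Sigma> X\<close> is given by its three morphisms \<open>(u, v, w)\<close>, which determine
  the objects. The suspension is only required to be an autoequivalence; this includes
  the case of an automorphism.\<close>

record ('o, 'm, 'k) tricat = "('o, 'm, 'k) lincat" +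
  Susp :: "('o, 'm, 'o, 'm) fctr"
  Tri :: "('m \<times> 'm \<times> 'm) set"

locale triangulated_category = linear_category K C
  for K :: "('k, 'r) ring_scheme" and C :: "('o, 'm, 'k, 'z) tricat_scheme" (structure) +
  assumes Susp_linear: "linear_functor K C C (Susp C)"
    and Susp_equivalence: "is_equivalence C C (Susp C)"
    and Tri_Hom: "(u, v, w) \<in> Tri C \<Longrightarrow>
      \<exists>X Y Z. u \<in> Hom C X Y \<and> v \<in> Hom C Y Z \<and> w \<in> Hom C Z (omap (Susp C) X)"
    and TR1_iso: "\<lbrakk>(u, v, w) \<in> Tri C;
        u \<in> Hom C X Y; v \<in> Hom C Y Z; w \<in> Hom C Z (omap (Susp C) X);
        u' \<in> Hom C X' Y'; v' \<in> Hom C Y' Z'; w' \<in> Hom C Z' (omap (Susp C) X');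
        a \<in> Hom C X X'; b \<in> Hom C Y Y'; c \<in> Hom C Z Z'; is_iso C a; is_iso C b; is_iso C c;
        b \<cdot> u = u' \<cdot> a; c \<cdot> v = v' \<cdot> b; amap (Susp C) a \<cdot> w = w' \<cdot> c\<rbrakk>
      \<Longrightarrow> (u', v', w') \<in> Tri C"
    and TR1_Ident: "\<lbrakk>X \<in> Obj C; zero_object C Z\<rbrakk>
      \<Longrightarrow> (Ident C X, Zero C X Z, Zero C Z (omap (Susp C) X)) \<in> Tri C"
    and TR1_cone: "u \<in> Hom C X Y \<Longrightarrow> \<exists>v w. (u, v, w) \<in> Tri C"
    and TR2: "\<lbrakk>u \<in> Hom C X Y; v \<in> Hom C Y Z; w \<in> Hom C Z (omap (Susp C) X)\<rbrakk>
      \<Longrightarrow> (u, v, w) \<in> Tri C \<longleftrightarrow>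
        (v, w, \<ominus>\<^bsub>hom_group C (omap (Susp C) X) (omap (Susp C) Y)\<^esub> amap (Susp C) u) \<in> Tri C"
    and TR3: "\<lbrakk>(u, v, w) \<in> Tri C; (u', v', w') \<in> Tri C;
        u \<in> Hom C X Y; v \<in> Hom C Y Z; u' \<in> Hom C X' Y'; v' \<in> Hom C Y' Z';
        a \<in> Hom C X X'; b \<in> Hom C Y Y'; b \<cdot> u = u' \<cdot> a\<rbrakk>
      \<Longrightarrow> \<exists>c \<in> Hom C Z Z'. c \<cdot> v = v' \<cdot> b \<and> amap (Susp C) a \<cdot> w = w' \<cdot> c"
    and TR4: "\<lbrakk>u \<in> Hom C X Y; v \<in> Hom C Y Z;
        (u, i, i') \<in> Tri C; i \<in> Hom C Y Z';
        (v, j, j') \<in> Tri C; j \<in> Hom C Z X';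
        (v \<cdot> u, k, k') \<in> Tri C; k \<in> Hom C Z Y'\<rbrakk>
      \<Longrightarrow> \<exists>f \<in> Hom C Z' Y'. \<exists>g \<in> Hom C Y' X'.
        (f, g, amap (Susp C) i \<cdot> j') \<in> Tri C \<and>
        f \<cdot> i = k \<cdot> v \<and> k' \<cdot> f = i' \<and> g \<cdot> k = j \<and> j' \<cdot> g = amap (Susp C) u \<cdot> k'"

definition triangle_functor ::
  "('o, 'm, 'k, 'y) tricat_scheme \<Rightarrow> ('p, 'n, 'k, 'z) tricat_scheme \<Rightarrow>
   ('o, 'm, 'p, 'n) fctr \<Rightarrow> bool" where
  "triangle_functor C D F \<longleftrightarrow> additive_functor C D F \<and>
     (\<exists>\<theta>. natural_iso C D (comp_fctr F (Susp C)) (comp_fctr (Susp D) F) \<theta> \<and>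
       (\<forall>X Y u v w. u \<in> Hom C X Y \<and> (u, v, w) \<in> Tri C \<longrightarrow>
         (amap F u, amap F v, \<theta> X \<cdot>\<^bsub>D\<^esub> amap F w) \<in> Tri D))"

subsection \<open>Serre duality\<close>

definition scalar_module :: "('k, 'r) ring_scheme \<Rightarrow> ('k, 'k) module" where
  "scalar_module K = \<lparr>carrier = carrier K, monoid.mult = monoid.mult K, one = one K,
     zero = zero K, add = add K, smult = monoid.mult K\<rparr>"

definition dual_space ::
  "('k, 'r) ring_scheme \<Rightarrow> ('k, 'v, 'z) module_scheme \<Rightarrow> ('k, 'v \<Rightarrow> 'k) module" where
  "dual_space K V = (ring.func_space K (carrier V))
     \<lparr>carrier := module_hom K V (scalar_module K) \<inter> extensional (carrier V)\<rparr>"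

text \<open>\<open>\<phi> X Y\<close> is the isomorphism from \<open>Hom(X, Y)\<close> to the dual of \<open>Hom(Y, \<nu> X)\<close>; the last two
  conditions are its naturality in \<open>X\<close> and in \<open>Y\<close>.\<close>

definition serre_functor ::
  "('k, 'r) ring_scheme \<Rightarrow> ('o, 'm, 'k, 'z) tricat_scheme \<Rightarrow> ('o, 'm, 'o, 'm) fctr \<Rightarrow> bool" where
  "serre_functor K C \<nu> \<longleftrightarrow> triangle_functor C C \<nu> \<and> is_equivalence C C \<nu> \<and>
     (\<exists>\<phi>.
       (\<forall>X \<in> Obj C. \<forall>Y \<in> Obj C.
         \<phi> X Y \<in> module_hom K (hom_module C X Y) (dual_space K (hom_module C Y (omap \<nu> X))) \<and>
         bij_betw (\<phi> X Y) (Hom C X Y) (carrier (dual_space K (hom_module C Y (omap \<nu> X))))) \<and>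
       (\<forall>X X' Y. \<forall>a \<in> Hom C X' X. \<forall>f \<in> Hom C X Y. \<forall>g \<in> Hom C Y (omap \<nu> X').
         \<phi> X' Y (f \<cdot>\<^bsub>C\<^esub> a) g = \<phi> X Y f (amap \<nu> a \<cdot>\<^bsub>C\<^esub> g)) \<and>
       (\<forall>X Y Y'. \<forall>b \<in> Hom C Y Y'. \<forall>f \<in> Hom C X Y. \<forall>g \<in> Hom C Y' (omap \<nu> X).
         \<phi> X Y' (b \<cdot>\<^bsub>C\<^esub> f) g = \<phi> X Y f (g \<cdot>\<^bsub>C\<^esub> b)))"

definition has_serre_duality ::
  "('k, 'r) ring_scheme \<Rightarrow> ('o, 'm, 'k, 'z) tricat_scheme \<Rightarrow> bool" where
  "has_serre_duality K C \<longleftrightarrow> (\<exists>\<nu>. serre_functor K C \<nu>)"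

subsection \<open>Rigid objects\<close>

definition Ext1 :: "('o, 'm, 'k, 'z) tricat_scheme \<Rightarrow> 'o \<Rightarrow> 'o \<Rightarrow> 'm set" where
  "Ext1 C X Y = Hom C X (omap (Susp C) Y)"

definition rigid :: "('o, 'm, 'k, 'z) tricat_scheme \<Rightarrow> 'o \<Rightarrow> bool" where
  "rigid C R \<longleftrightarrow> R \<in> Obj C \<and> Ext1 C R R = {Zero C R (omap (Susp C) R)}"

definition perp_objects :: "('o, 'm, 'z) addcat_scheme \<Rightarrow> 'o \<Rightarrow> 'o set" where
  "perp_objects C R = {Y \<in> Obj C. Hom C R Y = {Zero C R Y}}"

end

theory Submission
  imports Defs "HOL-Algebra.AbelCoset"
begin

text \<open>
  Write \<open>\<X>\<close> for the objects \<open>Y\<close> with \<open>Hom(R, Y) = 0\<close>. A morphism factors through \<open>\<X>\<close> iff it acts as zero on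
  \<open>Hom(R, -)\<close>: approximate its source \<open>A\<close> by a morphism \<open>r : R\<^sup>n \<rightarrow> A\<close> through which every morphism
  \<open>R \<rightarrow> A\<close> factors; by rigidity the cone of \<open>r\<close> lies in \<open>\<X>\<close> (\<open>perp_detected\<close>). So \<open>Hom(R, -)\<close>
  is a faithful functor on the quotient \<open>\<C>/[\<X>]\<close>, and it is still represented by \<open>R\<close>.

  In a triangle \<open>R\<^sup>n \<rightarrow> B \<rightarrow> D \<rightarrow> \<Sigma> R\<^sup>n\<close> every morphism \<open>R \<rightarrow> D\<close> lifts to \<open>B\<close>, by rigidity. Therefore
  \<open>B \<rightarrow> D\<close>, which is a weak cokernel of \<open>R\<^sup>n \<rightarrow> B\<close> in \<open>\<C>\<close>, becomes an epimorphism and hence a cokernel in the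
  quotient. Every morphism \<open>f : A \<rightarrow> B\<close> has a cokernel of this kind, that of \<open>R\<^sup>n \<rightarrow> A \<rightarrow> B\<close>
  (\<open>cokernel_is_cone\<close>), and so every cokernel is of this kind up to isomorphism. Such triangles can be
  pulled back along \<open>Y \<rightarrow> D\<close>, giving \<open>R\<^sup>n \<rightarrow> P' \<rightarrow> Y\<close>, and comparing \<open>P'\<close> with the pullback in the quotient
  shows that cokernels are stable under pullback (\<open>cokernels_pullback_stable\<close>).

  Kernels and pushouts are dual. By Serre duality \<open>\<X>\<close> is also the class of objects \<open>Y\<close> with
  \<open>Hom(Y, \<nu> R) = 0\<close> (\<open>perp_objects_op\<close>), and \<open>\<nu> R\<close> is rigid (\<open>rigid_nu\<close>). So the same argument applies in the
  opposite category with \<open>\<nu> R\<close> instead of \<open>R\<close>. To have it only once, it is carried out in a locale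
  (\<open>rigid_cones\<close>) over an additive category with a relation of consecutive morphisms, which is
  instantiated for both sides (\<open>rigid_cones_from\<close>, \<open>rigid_cocones_to\<close>).
\<close>

section \<open>Preadditive categories\<close>

lemma (in abelian_group_hom) hom_minus:
  assumes "x \<in> carrier G" and "y \<in> carrier G"
  shows "h (x \<ominus>\<^bsub>G\<^esub> y) = h x \<ominus>\<^bsub>H\<^esub> h y"
  using assms by (simp add: G.minus_eq H.minus_eq)

lemma (in abelian_group_hom) hom_finsum:
  assumes "finite I" and "f \<in> I \<rightarrow> carrier G"
  shows "h (finsum G f I) = finsum H (h \<circ> f) I"
  using assms
  by (induction I rule: finite_induct) (auto simp: G.finsum_closed Pi_def)

lemma (in abelian_group) minus_eq_zero_iff:
  assumes "x \<in> carrier G" and "y \<in> carrier G"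
  shows "x \<ominus> y = \<zero> \<longleftrightarrow> x = y"
proof
  assume "x \<ominus> y = \<zero>"
  then have "\<ominus> (\<ominus> y) = x"
    using assms minus_equality[of x "\<ominus> y"] by (simp add: minus_eq)
  then show "x = y" using assms by simp
qed (use assms in \<open>simp add: minus_eq r_neg\<close>)

lemma (in abelian_group) minus_minus_cancel:
  assumes "x \<in> carrier G" and "y \<in> carrier G"
  shows "x \<ominus> (x \<ominus> y) = y"
  using assms by (simp add: minus_eq minus_add a_assoc[symmetric] r_neg)

lemma hom_group_simps [simp]:
  "carrier (hom_group C X Y) = Hom C X Y"
  "zero (hom_group C X Y) = Zero C X Y"
  "add (hom_group C X Y) = Add C"
  by (simp_all add: hom_group_def)

context preadditive_category
begin

lemma hom_group_at:
  assumes "f \<in> Hom C X Y"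
  shows "abelian_group (hom_group C X Y)"
  using assms Hom_Obj hom_abelian_group by blast

lemma Zero_closed:
  assumes "X \<in> Obj C" and "Y \<in> Obj C"
  shows "Zero C X Y \<in> Hom C X Y"
proof -
  interpret abelian_group "hom_group C X Y" by (rule hom_abelian_group[OF assms])
  show ?thesis using zero_closed by simp
qed

lemma Add_closed:
  assumes "f \<in> Hom C X Y" and "g \<in> Hom C X Y"
  shows "f \<boxplus> g \<in> Hom C X Y"
proof -
  interpret abelian_group "hom_group C X Y" by (rule hom_group_at[OF assms(1)])
  show ?thesis using a_closed assms by simp
qed

lemma uminus_closed:
  assumes "f \<in> Hom C X Y"
  shows "\<ominus>\<^bsub>hom_group C X Y\<^esub> f \<in> Hom C X Y"
proof -
  interpret abelian_group "hom_group C X Y" by (rule hom_group_at[OF assms(1)])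
  show ?thesis using a_inv_closed assms by simp
qed

lemma uminus_uminus:
  assumes "f \<in> Hom C X Y"
  shows "\<ominus>\<^bsub>hom_group C X Y\<^esub> (\<ominus>\<^bsub>hom_group C X Y\<^esub> f) = f"
proof -
  interpret abelian_group "hom_group C X Y" by (rule hom_group_at[OF assms(1)])
  show ?thesis using minus_minus assms by simp
qed

lemma minus_closed:
  assumes "f \<in> Hom C X Y" and "g \<in> Hom C X Y"
  shows "f \<ominus>\<^bsub>hom_group C X Y\<^esub> g \<in> Hom C X Y"
proof -
  interpret abelian_group "hom_group C X Y" by (rule hom_group_at[OF assms(1)])
  show ?thesis using minus_closed assms by simp
qed

lemma minus_eq_Zero_iff:
  assumes "f \<in> Hom C X Y" and "g \<in> Hom C X Y"
  shows "f \<ominus>\<^bsub>hom_group C X Y\<^esub> g = Zero C X Y \<longleftrightarrow> f = g"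
  using abelian_group.minus_eq_zero_iff[OF hom_group_at[OF assms(1)]] assms by simp

lemma minus_minus_cancel:
  assumes "f \<in> Hom C X Y" and "g \<in> Hom C X Y"
  shows "f \<ominus>\<^bsub>hom_group C X Y\<^esub> (f \<ominus>\<^bsub>hom_group C X Y\<^esub> g) = g"
  using abelian_group.minus_minus_cancel[OF hom_group_at[OF assms(1)]] assms by simp

lemma precomp_hom:
  assumes "f \<in> Hom C X Y" and "Z \<in> Obj C"
  shows "abelian_group_hom (hom_group C Y Z) (hom_group C X Z) (\<lambda>g. g \<cdot> f)"
  using assms Hom_Obj[OF assms(1)]
  by (intro abelian_group_homI group_hom.intro group_hom_axioms.intro homI
      hom_abelian_group abelian_group.a_group[OF hom_abelian_group])
    (auto intro: Comp_closed Comp_Add_left)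

lemma postcomp_hom:
  assumes "g \<in> Hom C Y Z" and "X \<in> Obj C"
  shows "abelian_group_hom (hom_group C X Y) (hom_group C X Z) (\<lambda>f. g \<cdot> f)"
  using assms Hom_Obj[OF assms(1)]
  by (intro abelian_group_homI group_hom.intro group_hom_axioms.intro homI
      hom_abelian_group abelian_group.a_group[OF hom_abelian_group])
    (auto intro: Comp_closed Comp_Add_right)

lemma Zero_Comp:
  assumes "f \<in> Hom C X Y" and "Z \<in> Obj C"
  shows "Zero C Y Z \<cdot> f = Zero C X Z"
  using abelian_group_hom.hom_zero[OF precomp_hom[OF assms]] by simp

lemma Comp_Zero:
  assumes "g \<in> Hom C Y Z" and "X \<in> Obj C"
  shows "g \<cdot> Zero C X Y = Zero C X Z"
  using abelian_group_hom.hom_zero[OF postcomp_hom[OF assms]] by simp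

lemma Comp_uminus_left:
  assumes "f \<in> Hom C X Y" and "g \<in> Hom C Y Z"
  shows "(\<ominus>\<^bsub>hom_group C Y Z\<^esub> g) \<cdot> f = \<ominus>\<^bsub>hom_group C X Z\<^esub> (g \<cdot> f)"
  using abelian_group_hom.hom_a_inv[OF precomp_hom[OF assms(1), of Z], of g] assms Hom_Obj by force

lemma Comp_uminus_right:
  assumes "f \<in> Hom C X Y" and "g \<in> Hom C Y Z"
  shows "g \<cdot> (\<ominus>\<^bsub>hom_group C X Y\<^esub> f) = \<ominus>\<^bsub>hom_group C X Z\<^esub> (g \<cdot> f)"
  using abelian_group_hom.hom_a_inv[OF postcomp_hom[OF assms(2), of X], of f] assms Hom_Obj by force

lemma Comp_minus_left:
  assumes "f \<in> Hom C X Y" and "g \<in> Hom C Y Z" and "g' \<in> Hom C Y Z"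
  shows "(g \<ominus>\<^bsub>hom_group C Y Z\<^esub> g') \<cdot> f = g \<cdot> f \<ominus>\<^bsub>hom_group C X Z\<^esub> g' \<cdot> f"
  using abelian_group_hom.hom_minus[OF precomp_hom[OF assms(1), of Z], of g g'] assms Hom_Obj by force

lemma Comp_minus_right:
  assumes "f \<in> Hom C X Y" and "f' \<in> Hom C X Y" and "g \<in> Hom C Y Z"
  shows "g \<cdot> (f \<ominus>\<^bsub>hom_group C X Y\<^esub> f') = g \<cdot> f \<ominus>\<^bsub>hom_group C X Z\<^esub> g \<cdot> f'"
  using abelian_group_hom.hom_minus[OF postcomp_hom[OF assms(3), of X], of f f'] assms Hom_Obj by force

text \<open>Composing with the identity of \<open>S\<close>, written as the sum of the \<open>i j \<cdot> p j\<close>, recovers \<open>f\<close> from its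
  restrictions \<open>f \<cdot> i j\<close>.\<close>

lemma direct_sum_ext_left:
  assumes "is_direct_sum C n X S i p" and "f \<in> Hom C S Y" and "g \<in> Hom C S Y"
    and "\<And>j. j < n \<Longrightarrow> f \<cdot> i j = g \<cdot> i j"
  shows "f = g"
proof -
  have S: "S \<in> Obj C" and Y: "Y \<in> Obj C" using assms(2) Hom_Obj by auto
  have i: "i j \<in> Hom C (X j) S" and p: "p j \<in> Hom C S (X j)" if "j < n" for j
    using assms(1) that by (auto simp: is_direct_sum_def)
  have "h \<cdot> Ident C S = (\<Oplus>\<^bsub>hom_group C S Y\<^esub>j\<in>{..<n}. (h \<cdot> i j) \<cdot> p j)"
    if h: "h \<in> Hom C S Y" for h
  proof -
    interpret abelian_group_hom "hom_group C S S" "hom_group C S Y" "\<lambda>f. h \<cdot> f"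
      by (rule postcomp_hom[OF h S])
    have ip: "(\<lambda>j. i j \<cdot> p j) \<in> {..<n} \<rightarrow> carrier (hom_group C S S)"
      using i p by (auto intro: Comp_closed)
    have "h \<cdot> Ident C S = h \<cdot> (\<Oplus>\<^bsub>hom_group C S S\<^esub>j\<in>{..<n}. i j \<cdot> p j)"
      using assms(1) by (simp add: is_direct_sum_def)
    also have "\<dots> = (\<Oplus>\<^bsub>hom_group C S Y\<^esub>j\<in>{..<n}. h \<cdot> (i j \<cdot> p j))"
      using hom_finsum[OF _ ip] by (simp add: comp_def)
    also have "\<dots> = (\<Oplus>\<^bsub>hom_group C S Y\<^esub>j\<in>{..<n}. (h \<cdot> i j) \<cdot> p j)"
      using i p h by (intro H.finsum_cong') (auto intro!: Comp_closed Comp_assoc[symmetric])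
    finally show ?thesis .
  qed
  moreover have "(\<Oplus>\<^bsub>hom_group C S Y\<^esub>j\<in>{..<n}. (f \<cdot> i j) \<cdot> p j) =
      (\<Oplus>\<^bsub>hom_group C S Y\<^esub>j\<in>{..<n}. (g \<cdot> i j) \<cdot> p j)"
  proof -
    have "(g \<cdot> i j) \<cdot> p j \<in> Hom C S Y" if "j < n" for j
      using Comp_closed[OF p[OF that] Comp_closed[OF i[OF that] assms(3)]] .
    then show ?thesis
      using assms(4) abelian_monoid.finsum_cong'[OF abelian_group.axioms(1)[OF hom_group_at[OF assms(2)]], of "{..<n}" "{..<n}" "\<lambda>j. (g \<cdot> i j) \<cdot> p j" "\<lambda>j. (f \<cdot> i j) \<cdot> p j"]
      by (simp add: Pi_def)
  qed
  ultimately show ?thesis using Comp_Ident[OF assms(2)] Comp_Ident[OF assms(3)] assms(2,3) by simp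
qed

lemma direct_sum_copair:
  assumes "is_direct_sum C n X S i p" and "A \<in> Obj C"
    and e: "\<And>j. j < n \<Longrightarrow> e j \<in> Hom C (X j) A"
  obtains r where "r \<in> Hom C S A" and "\<And>j. j < n \<Longrightarrow> r \<cdot> i j = e j"
proof -
  have S: "S \<in> Obj C" using assms(1) by (simp add: is_direct_sum_def)
  have X: "X j \<in> Obj C" and i: "i j \<in> Hom C (X j) S" and p: "p j \<in> Hom C S (X j)"
    if "j < n" for j
    using assms(1) that by (auto simp: is_direct_sum_def)
  have pi: "p l \<cdot> i j = (if j = l then Ident C (X j) else Zero C (X j) (X l))"
    if "j < n" "l < n" for j l
    using assms(1) that by (auto simp: is_direct_sum_def)
  define r where "r = (\<Oplus>\<^bsub>hom_group C S A\<^esub>l\<in>{..<n}. e l \<cdot> p l)"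
  interpret SA: abelian_group "hom_group C S A" by (rule hom_abelian_group[OF S assms(2)])
  have ep: "(\<lambda>l. e l \<cdot> p l) \<in> {..<n} \<rightarrow> carrier (hom_group C S A)"
    using e p by (auto intro: Comp_closed)
  show thesis
  proof
    show "r \<in> Hom C S A" using SA.finsum_closed[OF ep] by (simp add: r_def)
    fix j assume j: "j < n"
    interpret abelian_group_hom "hom_group C S A" "hom_group C (X j) A" "\<lambda>f. f \<cdot> i j"
      by (rule precomp_hom[OF i[OF j] assms(2)])
    have "r \<cdot> i j = (\<Oplus>\<^bsub>hom_group C (X j) A\<^esub>l\<in>{..<n}. (e l \<cdot> p l) \<cdot> i j)"
      using hom_finsum[OF _ ep] by (simp add: comp_def r_def)
    also have "\<dots> = (\<Oplus>\<^bsub>hom_group C (X j) A\<^esub>l\<in>{..<n}.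
        if j = l then e j else zero (hom_group C (X j) A))"
    proof (rule H.finsum_cong')
      show "(\<lambda>l. if j = l then e j else \<zero>\<^bsub>hom_group C (X j) A\<^esub>)
          \<in> {..<n} \<rightarrow> carrier (hom_group C (X j) A)"
        using e X j assms(2) Zero_closed by auto
      fix l assume "l \<in> {..<n}"
      then have l: "l < n" by simp
      have "(e l \<cdot> p l) \<cdot> i j = e l \<cdot> (p l \<cdot> i j)"
        by (rule Comp_assoc[OF i[OF j] p[OF l] e[OF l]])
      then show "(e l \<cdot> p l) \<cdot> i j = (if j = l then e j else \<zero>\<^bsub>hom_group C (X j) A\<^esub>)"
        using pi[OF j l] Comp_Ident[OF e[OF l]] Comp_Zero[OF e[OF l] X[OF j]] by simp
    qed simp
    also have "\<dots> = e j"
      by (rule H.finsum_singleton[where f = "\<lambda>_. e j"]) (use j e[OF j] in auto)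
    finally show "r \<cdot> i j = e j" .
  qed
qed

end

section \<open>Opposite categories and additive functors\<close>

text \<open>The argument below produces cokernels; kernels are obtained by running it in the opposite category.
  Only the additive structure is reversed: triangles enter the argument through a relation between
  morphisms that is given separately for each of the two directions.\<close>

definition op_cat :: "('o, 'm, 'z) addcat_scheme \<Rightarrow> ('o, 'm, 'z) addcat_scheme" where
  "op_cat C = C\<lparr>Hom := (\<lambda>X Y. Hom C Y X), Comp := (\<lambda>g f. Comp C f g),
     Zero := (\<lambda>X Y. Zero C Y X)\<rparr>"

lemma op_cat_simps [simp]:
  "Obj (op_cat C) = Obj C"
  "Hom (op_cat C) X Y = Hom C Y X"
  "Comp (op_cat C) g f = Comp C f g"
  "Ident (op_cat C) = Ident C"
  "Add (op_cat C) = Add C"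
  "Zero (op_cat C) X Y = Zero C Y X"
  by (simp_all add: op_cat_def)

lemma a_minus_op: "a_minus (hom_group (op_cat C) X Y) = a_minus (hom_group C Y X)"
  by (intro ext) (simp add: a_minus_def a_inv_def)

lemma finsum_op: "finsum (hom_group (op_cat C) X Y) = finsum (hom_group C Y X)"
  by (intro ext) (simp add: finsum_def)

lemma preadditive_category_op:
  assumes "preadditive_category C"
  shows "preadditive_category (op_cat C)"
proof -
  interpret preadditive_category C by fact
  show ?thesis
  proof (intro preadditive_category.intro category.intro preadditive_category_axioms.intro)
    fix X Y assume "X \<in> Obj (op_cat C)" and "Y \<in> Obj (op_cat C)"
    then interpret abelian_group "hom_group C Y X" by (simp add: hom_abelian_group)
    show "abelian_group (hom_group (op_cat C) X Y)"
      using abelian_group_axioms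
      by (simp add: abelian_group_def abelian_monoid_def abelian_group_axioms_def)
  qed (use Hom_Obj Hom_disjoint Comp_closed Comp_assoc Ident_closed Comp_Ident Ident_Comp
      Comp_Add_left Comp_Add_right in \<open>auto\<close>)
qed

lemma is_direct_sum_op: "is_direct_sum (op_cat C) n X S p i \<longleftrightarrow> is_direct_sum C n X S i p"
  unfolding is_direct_sum_def finsum_op by auto

lemma additive_category_op:
  assumes "additive_category C"
  shows "additive_category (op_cat C)"
proof -
  interpret additive_category C by fact
  interpret op: preadditive_category "op_cat C"
    by (rule preadditive_category_op) (rule preadditive_category_axioms)
  show ?thesis
  proof
    fix n :: nat and X assume "\<And>j. j < n \<Longrightarrow> X j \<in> Obj (op_cat C)"
    then obtain S i p where "is_direct_sum C n X S i p" using direct_sums[of n X] by auto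
    then show "\<exists>S i p. is_direct_sum (op_cat C) n X S i p" using is_direct_sum_op by metis
  qed
qed

lemma (in preadditive_category) direct_sum_ext_right:
  assumes "is_direct_sum C n X S i p" and "f \<in> Hom C Y S" and "g \<in> Hom C Y S"
    and "\<And>j. j < n \<Longrightarrow> p j \<cdot> f = p j \<cdot> g"
  shows "f = g"
  using preadditive_category.direct_sum_ext_left[OF preadditive_category_op[OF preadditive_category_axioms],
      of n X S p i f Y g] assms
  by (simp add: is_direct_sum_op)

lemma additive_functor_hom:
  assumes "preadditive_category C" and "preadditive_category D"
    and "additive_functor C D F" and "X \<in> Obj C" and "Y \<in> Obj C"
  shows "abelian_group_hom (hom_group C X Y) (hom_group D (omap F X) (omap F Y)) (amap F)"
proof -
  interpret C: preadditive_category C by fact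
  interpret D: preadditive_category D by fact
  have F: "is_functor C D F"
    and add: "\<And>f g. \<lbrakk>f \<in> Hom C X Y; g \<in> Hom C X Y\<rbrakk> \<Longrightarrow> amap F (f \<boxplus>\<^bsub>C\<^esub> g) = amap F f \<boxplus>\<^bsub>D\<^esub> amap F g"
    using assms(3) by (auto simp: additive_functor_def)
  have "omap F X \<in> Obj D" "omap F Y \<in> Obj D"
    and hom: "\<And>f. f \<in> Hom C X Y \<Longrightarrow> amap F f \<in> Hom D (omap F X) (omap F Y)"
    using F assms(4,5) by (auto simp: is_functor_def)
  then show ?thesis
    using assms(4,5) add
    by (intro abelian_group_homI group_hom.intro group_hom_axioms.intro homI
        C.hom_abelian_group D.hom_abelian_group
        abelian_group.a_group[OF C.hom_abelian_group] abelian_group.a_group[OF D.hom_abelian_group])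
      simp_all
qed

lemma additive_functor_Zero:
  assumes "preadditive_category C" and "preadditive_category D"
    and "additive_functor C D F" and "X \<in> Obj C" and "Y \<in> Obj C"
  shows "amap F (Zero C X Y) = Zero D (omap F X) (omap F Y)"
  using abelian_group_hom.hom_zero[OF additive_functor_hom[OF assms]] by simp

text \<open>A direct sum is given by equations between morphisms, and additive functors preserve these. This is
  applied to the suspension and to the projection onto an additive quotient.\<close>

lemma additive_functor_direct_sum:
  assumes "preadditive_category C" and "preadditive_category D"
    and "additive_functor C D F" and "is_direct_sum C n X S i p"
  shows "is_direct_sum D n (\<lambda>j. omap F (X j)) (omap F S) (\<lambda>j. amap F (i j)) (\<lambda>j. amap F (p j))"
proof -
  interpret C: preadditive_category C by fact
  interpret D: preadditive_category D by fact
  have S: "S \<in> Obj C"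
    and X: "\<And>j. j < n \<Longrightarrow> X j \<in> Obj C"
    and i: "\<And>j. j < n \<Longrightarrow> i j \<in> Hom C (X j) S"
    and p: "\<And>j. j < n \<Longrightarrow> p j \<in> Hom C S (X j)"
    and pi: "\<And>j l. j < n \<Longrightarrow> l < n \<Longrightarrow>
      p l \<cdot>\<^bsub>C\<^esub> i j = (if j = l then Ident C (X j) else Zero C (X j) (X l))"
    and sum: "(\<Oplus>\<^bsub>hom_group C S S\<^esub>j\<in>{..<n}. i j \<cdot>\<^bsub>C\<^esub> p j) = Ident C S"
    using assms(4) by (auto simp: is_direct_sum_def)
  have F: "is_functor C D F" using assms(3) by (simp add: additive_functor_def)
  have obj: "\<And>A. A \<in> Obj C \<Longrightarrow> omap F A \<in> Obj D"
    and hom: "\<And>A B f. f \<in> Hom C A B \<Longrightarrow> amap F f \<in> Hom D (omap F A) (omap F B)"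
    and ident: "\<And>A. A \<in> Obj C \<Longrightarrow> amap F (Ident C A) = Ident D (omap F A)"
    and comp: "\<And>A B E f g. f \<in> Hom C A B \<Longrightarrow> g \<in> Hom C B E \<Longrightarrow>
       amap F (g \<cdot>\<^bsub>C\<^esub> f) = amap F g \<cdot>\<^bsub>D\<^esub> amap F f"
    using F unfolding is_functor_def by blast+
  interpret h: abelian_group_hom "hom_group C S S" "hom_group D (omap F S) (omap F S)" "amap F"
    by (rule additive_functor_hom[OF assms(1-3) S S])
  have ip: "(\<lambda>j. i j \<cdot>\<^bsub>C\<^esub> p j) \<in> {..<n} \<rightarrow> carrier (hom_group C S S)"
    using i p by (auto intro: C.Comp_closed)
  have "Ident D (omap F S) = amap F (\<Oplus>\<^bsub>hom_group C S S\<^esub>j\<in>{..<n}. i j \<cdot>\<^bsub>C\<^esub> p j)"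
    using sum ident[OF S] by simp
  also have "\<dots> = (\<Oplus>\<^bsub>hom_group D (omap F S) (omap F S)\<^esub>j\<in>{..<n}. amap F (i j \<cdot>\<^bsub>C\<^esub> p j))"
    using h.hom_finsum[OF _ ip] by (simp add: comp_def)
  also have "\<dots> = (\<Oplus>\<^bsub>hom_group D (omap F S) (omap F S)\<^esub>j\<in>{..<n}. amap F (i j) \<cdot>\<^bsub>D\<^esub> amap F (p j))"
  proof (rule h.H.finsum_cong'[OF refl])
    show "(\<lambda>j. amap F (i j) \<cdot>\<^bsub>D\<^esub> amap F (p j))
        \<in> {..<n} \<rightarrow> carrier (hom_group D (omap F S) (omap F S))"
      using hom[OF i] hom[OF p] by (auto intro: D.Comp_closed)
  qed (use comp[OF p i] in simp)
  finally have "(\<Oplus>\<^bsub>hom_group D (omap F S) (omap F S)\<^esub>j\<in>{..<n}. amap F (i j) \<cdot>\<^bsub>D\<^esub> amap F (p j)) =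
      Ident D (omap F S)" by simp
  moreover have "amap F (p l) \<cdot>\<^bsub>D\<^esub> amap F (i j) =
      (if j = l then Ident D (omap F (X j)) else Zero D (omap F (X j)) (omap F (X l)))"
    if "j < n" "l < n" for j l
    using comp[OF i[OF that(1)] p[OF that(2)]] pi[OF that] ident[OF X] that
      additive_functor_Zero[OF assms(1-3) X X] by auto
  ultimately show ?thesis
    using S X obj hom[OF i] hom[OF p] by (simp add: is_direct_sum_def)
qed

section \<open>Approximations by copies of one object\<close>

text \<open>The objects \<open>R\<^sup>n\<close>. They replace the closure of \<open>R\<close> under direct sums and summands: they suffice for
  approximations.\<close>

definition copies :: "('o, 'm, 'z) addcat_scheme \<Rightarrow> 'o \<Rightarrow> 'o set" where
  "copies C R = {E. \<exists>n i p. is_direct_sum C n (\<lambda>_. R) E i p}"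

lemma copies_op: "copies (op_cat C) R = copies C R"
  unfolding copies_def is_direct_sum_op by blast

lemma copies_Obj: "E \<in> copies C R \<Longrightarrow> E \<in> Obj C"
  by (auto simp: copies_def is_direct_sum_def)

text \<open>The inclusions of the summands of \<open>E\<close> are themselves morphisms from \<open>R\<close>.\<close>

lemma (in preadditive_category) copies_ext:
  assumes "E \<in> copies C R" and "f \<in> Hom C E Y" and "g \<in> Hom C E Y"
    and "\<And>x. x \<in> Hom C R E \<Longrightarrow> f \<cdot> x = g \<cdot> x"
  shows "f = g"
proof -
  obtain n i p where s: "is_direct_sum C n (\<lambda>_. R) E i p" using assms(1) by (auto simp: copies_def)
  then have "f \<cdot> i j = g \<cdot> i j" if "j < n" for j
    using that assms(4) by (simp add: is_direct_sum_def)
  then show ?thesis using direct_sum_ext_left[OF s assms(2,3)] by simp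
qed

lemma (in additive_category) finite_copies_cover:
  assumes "R \<in> Obj C" and "A \<in> Obj C" and "finite B" and "B \<subseteq> Hom C R A"
  obtains E r where "E \<in> copies C R" and "r \<in> Hom C E A"
    and "\<And>b. b \<in> B \<Longrightarrow> \<exists>t \<in> Hom C R E. b = r \<cdot> t"
proof -
  obtain n and b :: "nat \<Rightarrow> 'b" where B: "B = b ` {..<n}"
    using finite_imp_nat_seg_image_inj_on[OF assms(3)] by (metis lessThan_def)
  obtain E i p where s: "is_direct_sum C n (\<lambda>_. R) E i p"
    using direct_sums[of n "\<lambda>_. R"] assms(1) by blast
  have bH: "b j \<in> Hom C R A" if "j < n" for j using that B assms(4) by blast
  obtain r where r: "r \<in> Hom C E A" "\<And>j. j < n \<Longrightarrow> r \<cdot> i j = b j"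
    using direct_sum_copair[OF s assms(2), of b] bH by blast
  show thesis
  proof
    show "E \<in> copies C R" using s by (auto simp: copies_def)
    show "r \<in> Hom C E A" by (rule r)
    fix c assume "c \<in> B"
    then obtain j where "j < n" "c = b j" using B by auto
    then show "\<exists>t \<in> Hom C R E. c = r \<cdot> t"
      using r(2) s by (intro bexI[of _ "i j"]) (auto simp: is_direct_sum_def)
  qed
qed

text \<open>A basis-free way to use finite dimension: to show that all of \<open>Hom C X Y\<close> has a property it is enough
  to check the finite set \<open>B\<close> and closure under the vector space operations. The scalars are only
  mentioned for \<open>C\<close> itself, so that the same fact serves morphisms from and morphisms to a given
  object.\<close>

lemma (in linear_category) finite_spanning_set:
  assumes "hom_finite K C" and "X \<in> Obj C" and "Y \<in> Obj C"
  obtains B where "finite B" and "B \<subseteq> Hom C X Y"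
    and "\<And>M. \<lbrakk>B \<subseteq> M; Zero C X Y \<in> M; M \<subseteq> Hom C X Y;
      \<And>f g. \<lbrakk>f \<in> M; g \<in> M\<rbrakk> \<Longrightarrow> f \<boxplus> g \<in> M; \<And>c f. \<lbrakk>c \<in> carrier K; f \<in> M\<rbrakk> \<Longrightarrow> Scale C c f \<in> M\<rbrakk>
      \<Longrightarrow> Hom C X Y \<subseteq> M"
proof -
  interpret V: vectorspace K "hom_module C X Y" by (rule hom_vectorspace[OF assms(2,3)])
  have simps: "carrier (hom_module C X Y) = Hom C X Y" "add (hom_module C X Y) = Add C"
    "zero (hom_module C X Y) = Zero C X Y" "smult (hom_module C X Y) = Scale C"
    by (simp_all add: hom_module_def)
  have "V.fin_dim" using assms by (simp add: hom_finite_def)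
  then obtain B where B: "finite B" "B \<subseteq> Hom C X Y" "V.span B = Hom C X Y"
    unfolding V.fin_dim_def simps by blast
  show thesis
  proof
    fix M
    assume M: "B \<subseteq> M" "Zero C X Y \<in> M" "M \<subseteq> Hom C X Y"
      "\<And>f g. \<lbrakk>f \<in> M; g \<in> M\<rbrakk> \<Longrightarrow> f \<boxplus> g \<in> M"
      "\<And>c f. \<lbrakk>c \<in> carrier K; f \<in> M\<rbrakk> \<Longrightarrow> Scale C c f \<in> M"
    have in_M: "finsum (hom_module C X Y) (\<lambda>v. Scale C (a v) v) A \<in> M"
      if "finite A" "A \<subseteq> B" "a \<in> A \<rightarrow> carrier K" for A a
      using that
    proof (induction A rule: finite_induct)
      case empty
      then show ?case using M(2) by (simp add: simps)
    next
      case (insert x A)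
      have sc: "Scale C (a v) v \<in> M" if "v \<in> insert x A" for v
        using that insert.prems M(1,5) by blast
      have "finsum (hom_module C X Y) (\<lambda>v. Scale C (a v) v) (insert x A) =
          Scale C (a x) x \<boxplus> finsum (hom_module C X Y) (\<lambda>v. Scale C (a v) v) A"
        using V.M.finsum_insert[OF insert.hyps, of "\<lambda>v. Scale C (a v) v"] sc M(3)
        by (auto simp: simps)
      then show ?case using M(4)[OF sc insert.IH] insert.prems by auto
    qed
    show "Hom C X Y \<subseteq> M"
    proof
      fix f assume "f \<in> Hom C X Y"
      then have "f \<in> V.span B" using B(3) by simp
      then obtain a A where "f = V.lincomb a A" "finite A" "A \<subseteq> B" "a \<in> A \<rightarrow> carrier K"
        unfolding V.span_def by blast
      then show "f \<in> M" using in_M by (simp add: V.lincomb_def simps)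
    qed
  qed (use B in auto)
qed

lemma (in linear_category) Scale_closed:
  assumes "c \<in> carrier K" and "f \<in> Hom C X Y"
  shows "Scale C c f \<in> Hom C X Y"
proof -
  interpret V: vectorspace K "hom_module C X Y"
    using assms(2) Hom_Obj hom_vectorspace by blast
  show ?thesis using V.smult_closed[of c f] assms by (simp add: hom_module_def)
qed

text \<open>Take \<open>r\<close> to be the morphism \<open>R\<^sup>n \<rightarrow> A\<close> given by a spanning set of \<open>Hom C R A\<close>: the morphisms that
  factor through \<open>r\<close> form a subspace containing the spanning set.\<close>

lemma (in linear_category) right_approximation:
  assumes "hom_finite K C" and "R \<in> Obj C" and "A \<in> Obj C"
  shows "\<exists>E \<in> copies C R. \<exists>r \<in> Hom C E A. \<forall>x \<in> Hom C R A. \<exists>t \<in> Hom C R E. x = r \<cdot> t"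
proof -
  obtain B where B: "finite B" "B \<subseteq> Hom C R A"
    and span: "\<And>M. \<lbrakk>B \<subseteq> M; Zero C R A \<in> M; M \<subseteq> Hom C R A;
      \<And>f g. \<lbrakk>f \<in> M; g \<in> M\<rbrakk> \<Longrightarrow> f \<boxplus> g \<in> M; \<And>c f. \<lbrakk>c \<in> carrier K; f \<in> M\<rbrakk> \<Longrightarrow> Scale C c f \<in> M\<rbrakk>
      \<Longrightarrow> Hom C R A \<subseteq> M"
    using finite_spanning_set[OF assms] by metis
  obtain E r where E: "E \<in> copies C R" and r: "r \<in> Hom C E A"
    and cover: "\<And>b. b \<in> B \<Longrightarrow> \<exists>t \<in> Hom C R E. b = r \<cdot> t"
    using finite_copies_cover[OF assms(2,3) B] by metis
  have "Hom C R A \<subseteq> (\<lambda>t. r \<cdot> t) ` Hom C R E"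
  proof (rule span)
    have "E \<in> Obj C" by (rule copies_Obj[OF E])
    then show "Zero C R A \<in> (\<lambda>t. r \<cdot> t) ` Hom C R E"
      using Comp_Zero[OF r assms(2)] Zero_closed[OF assms(2)] by (metis imageI)
    show "f \<boxplus> g \<in> (\<lambda>t. r \<cdot> t) ` Hom C R E"
      if fg: "f \<in> (\<lambda>t. r \<cdot> t) ` Hom C R E" "g \<in> (\<lambda>t. r \<cdot> t) ` Hom C R E" for f g
      using fg Comp_Add_right[OF _ _ r] Add_closed[of _ R E] by (auto simp: image_iff) metis
    show "Scale C c f \<in> (\<lambda>t. r \<cdot> t) ` Hom C R E"
      if c: "c \<in> carrier K" and f: "f \<in> (\<lambda>t. r \<cdot> t) ` Hom C R E" for c f
    proof -
      obtain t where t: "t \<in> Hom C R E" "f = r \<cdot> t" using f by blast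
      have "Scale C c t \<in> Hom C R E" by (rule Scale_closed[OF c t(1)])
      then show ?thesis using Comp_Scale_right[OF c t(1) r] t(2) by (metis imageI)
    qed
  qed (use cover r in \<open>auto intro: Comp_closed\<close>)
  then show ?thesis using E r by blast
qed

lemma (in linear_category) left_approximation:
  assumes "hom_finite K C" and "N \<in> Obj C" and "A \<in> Obj C"
  shows "\<exists>E \<in> copies C N. \<exists>r \<in> Hom C A E. \<forall>x \<in> Hom C A N. \<exists>t \<in> Hom C E N. x = t \<cdot> r"
proof -
  interpret op: additive_category "op_cat C"
    by (rule additive_category_op) (rule additive_category_axioms)
  obtain B where B: "finite B" "B \<subseteq> Hom C A N"
    and span: "\<And>M. \<lbrakk>B \<subseteq> M; Zero C A N \<in> M; M \<subseteq> Hom C A N;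
      \<And>f g. \<lbrakk>f \<in> M; g \<in> M\<rbrakk> \<Longrightarrow> f \<boxplus> g \<in> M; \<And>c f. \<lbrakk>c \<in> carrier K; f \<in> M\<rbrakk> \<Longrightarrow> Scale C c f \<in> M\<rbrakk>
      \<Longrightarrow> Hom C A N \<subseteq> M"
    using finite_spanning_set[OF assms(1,3,2)] by metis
  obtain E r where E: "E \<in> copies C N" and r: "r \<in> Hom C A E"
    and cover: "\<And>b. b \<in> B \<Longrightarrow> \<exists>t \<in> Hom C E N. b = t \<cdot> r"
    using op.finite_copies_cover[of N A B] assms B by (simp add: copies_op) metis
  have "Hom C A N \<subseteq> (\<lambda>t. t \<cdot> r) ` Hom C E N"
  proof (rule span)
    have "E \<in> Obj C" by (rule copies_Obj[OF E])
    then show "Zero C A N \<in> (\<lambda>t. t \<cdot> r) ` Hom C E N"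
      using Zero_Comp[OF r assms(2)] Zero_closed[OF _ assms(2)] by (metis imageI)
    show "f \<boxplus> g \<in> (\<lambda>t. t \<cdot> r) ` Hom C E N"
      if fg: "f \<in> (\<lambda>t. t \<cdot> r) ` Hom C E N" "g \<in> (\<lambda>t. t \<cdot> r) ` Hom C E N" for f g
      using fg Comp_Add_left[OF r] Add_closed[of _ E N] by (auto simp: image_iff) metis
    show "Scale C c f \<in> (\<lambda>t. t \<cdot> r) ` Hom C E N"
      if c: "c \<in> carrier K" and f: "f \<in> (\<lambda>t. t \<cdot> r) ` Hom C E N" for c f
    proof -
      obtain t where t: "t \<in> Hom C E N" "f = t \<cdot> r" using f by blast
      have "Scale C c t \<in> Hom C E N" by (rule Scale_closed[OF c t(1)])
      then show ?thesis using Comp_Scale_left[OF c r t(1)] t(2) by (metis imageI)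
    qed
  qed (use cover r in \<open>auto intro: Comp_closed\<close>)
  then show ?thesis using E r by blast
qed

section \<open>Additive quotients detected by a test object\<close>

text \<open>The ideal is assumed to consist of the morphisms that \<open>Hom C R\<close> does not see. Then two morphisms are
  identified exactly if they act equally on \<open>Hom C R\<close>, which is plainly compatible with composition and
  addition, and \<open>Hom C R\<close> induces a faithful functor on the quotient.\<close>

locale detected_quotient = additive_category C for C :: "('o, 'm, 'z) addcat_scheme" (structure) +
  fixes S :: "'o set" and R :: 'o
  assumes R_Obj: "R \<in> Obj C"
    and factoring_eq: "\<lbrakk>X \<in> Obj C; Y \<in> Obj C\<rbrakk> \<Longrightarrow>
      factoring C S X Y = {f \<in> Hom C X Y. \<forall>x \<in> Hom C R X. f \<cdot> x = Zero C R Y}"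
begin

abbreviation Q :: "('o, 'm set) addcat" where "Q \<equiv> quotient_category C S"

definition cls :: "'m \<Rightarrow> 'm set" where "cls f = factoring_rel C S `` {f}"

lemma mem_cls_iff:
  assumes f: "f \<in> Hom C X Y"
  shows "g \<in> cls f \<longleftrightarrow> g \<in> Hom C X Y \<and> (\<forall>x \<in> Hom C R X. f \<cdot> x = g \<cdot> x)"
proof -
  have XY: "X \<in> Obj C" "Y \<in> Obj C" using f Hom_Obj by auto
  have "f \<ominus>\<^bsub>hom_group C X Y\<^esub> g \<in> factoring C S X Y \<longleftrightarrow> (\<forall>x \<in> Hom C R X. f \<cdot> x = g \<cdot> x)"
    if g: "g \<in> Hom C X Y"
  proof -
    have "(f \<ominus>\<^bsub>hom_group C X Y\<^esub> g) \<cdot> x = Zero C R Y \<longleftrightarrow> f \<cdot> x = g \<cdot> x"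
      if x: "x \<in> Hom C R X" for x
      using Comp_minus_left[OF x f g] minus_eq_Zero_iff[OF Comp_closed[OF x f] Comp_closed[OF x g]]
      by simp
    then show ?thesis using factoring_eq[OF XY] minus_closed[OF f g] by blast
  qed
  moreover have "g \<in> cls f \<longleftrightarrow> g \<in> Hom C X Y \<and> f \<ominus>\<^bsub>hom_group C X Y\<^esub> g \<in> factoring C S X Y"
    using f Hom_disjoint[OF f] unfolding cls_def factoring_rel_def by blast
  ultimately show ?thesis by blast
qed

lemma cls_refl: "f \<in> Hom C X Y \<Longrightarrow> f \<in> cls f"
  by (simp add: mem_cls_iff)

text \<open>Equations in the quotient can be tested on morphisms from \<open>R\<close>.\<close>

lemma cls_eq_iff:
  assumes "f \<in> Hom C X Y" and "g \<in> Hom C X Y"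
  shows "cls f = cls g \<longleftrightarrow> (\<forall>x \<in> Hom C R X. f \<cdot> x = g \<cdot> x)"
  using mem_cls_iff[OF assms(1)] mem_cls_iff[OF assms(2)] cls_refl[OF assms(2)] assms(2) by force

lemma Obj_Q [simp]: "Obj Q = Obj C"
  by (simp add: quotient_category_def Let_def)

lemma Hom_Q: "Hom Q X Y = cls ` Hom C X Y"
  by (auto simp: quotient_category_def Let_def quotient_def cls_def)

lemma cls_in_Hom: "f \<in> Hom C X Y \<Longrightarrow> cls f \<in> Hom Q X Y"
  by (simp add: Hom_Q)

lemma Hom_Q_cases:
  assumes "F \<in> Hom Q X Y"
  obtains f where "f \<in> Hom C X Y" and "F = cls f"
  using assms by (auto simp: Hom_Q)

lemma Zero_Q: "Zero Q X Y = cls (Zero C X Y)"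
  by (simp add: quotient_category_def Let_def cls_def)

lemma Ident_Q: "Ident Q X = cls (Ident C X)"
  by (simp add: quotient_category_def Let_def cls_def)

lemma Comp_Q:
  assumes f: "f \<in> Hom C X Y" and g: "g \<in> Hom C Y Z"
  shows "cls g \<cdot>\<^bsub>Q\<^esub> cls f = cls (g \<cdot> f)"
proof -
  have "cls (b \<cdot> a) = cls (g \<cdot> f)" if b: "b \<in> cls g" and a: "a \<in> cls f" for a b
  proof -
    have a': "a \<in> Hom C X Y" and af: "\<And>x. x \<in> Hom C R X \<Longrightarrow> f \<cdot> x = a \<cdot> x"
      and b': "b \<in> Hom C Y Z" and bg: "\<And>x. x \<in> Hom C R Y \<Longrightarrow> g \<cdot> x = b \<cdot> x"
      using a b mem_cls_iff[OF f] mem_cls_iff[OF g] by auto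
    have "(b \<cdot> a) \<cdot> x = (g \<cdot> f) \<cdot> x" if x: "x \<in> Hom C R X" for x
      using Comp_assoc[OF x a' b'] Comp_assoc[OF x f g] af[OF x] bg[OF Comp_closed[OF x a']]
      by simp
    then show ?thesis
      using cls_eq_iff[OF Comp_closed[OF a' b'] Comp_closed[OF f g]] by blast
  qed
  then have "(\<Union>b \<in> cls g. \<Union>a \<in> cls f. cls (b \<cdot> a)) = cls (g \<cdot> f)"
    using cls_refl[OF f] cls_refl[OF g] by blast
  then show ?thesis by (simp add: quotient_category_def Let_def cls_def)
qed

lemma Add_Q:
  assumes f: "f \<in> Hom C X Y" and g: "g \<in> Hom C X Y"
  shows "cls f \<boxplus>\<^bsub>Q\<^esub> cls g = cls (f \<boxplus> g)"
proof -
  have "cls (a \<boxplus> b) = cls (f \<boxplus> g)" if a: "a \<in> cls f" and b: "b \<in> cls g" for a b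
  proof -
    have a': "a \<in> Hom C X Y" and af: "\<And>x. x \<in> Hom C R X \<Longrightarrow> f \<cdot> x = a \<cdot> x"
      and b': "b \<in> Hom C X Y" and bg: "\<And>x. x \<in> Hom C R X \<Longrightarrow> g \<cdot> x = b \<cdot> x"
      using a b mem_cls_iff[OF f] mem_cls_iff[OF g] by auto
    have "(a \<boxplus> b) \<cdot> x = (f \<boxplus> g) \<cdot> x" if x: "x \<in> Hom C R X" for x
      using Comp_Add_left[OF x a' b'] Comp_Add_left[OF x f g] af[OF x] bg[OF x] by simp
    then show ?thesis
      using cls_eq_iff[OF Add_closed[OF a' b'] Add_closed[OF f g]] by blast
  qed
  then have "(\<Union>a \<in> cls f. \<Union>b \<in> cls g. cls (a \<boxplus> b)) = cls (f \<boxplus> g)"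
    using cls_refl[OF f] cls_refl[OF g] by blast
  then show ?thesis by (simp add: quotient_category_def Let_def cls_def)
qed

lemma category_Q: "category Q"
proof (rule category.intro)
  fix F X Y assume "F \<in> Hom Q X Y"
  then show "X \<in> Obj Q \<and> Y \<in> Obj Q" using Hom_Obj by (auto simp: Hom_Q)
next
  fix F X Y X' Y' assume "F \<in> Hom Q X Y" and "F \<in> Hom Q X' Y'"
  then obtain f g where f: "f \<in> Hom C X Y" "F = cls f" and g: "g \<in> Hom C X' Y'" "F = cls g"
    by (auto simp: Hom_Q)
  then have "f \<in> Hom C X' Y'" using cls_refl[OF f(1)] mem_cls_iff[OF g(1)] by auto
  then show "X = X' \<and> Y = Y'" using Hom_disjoint f(1) by blast
next
  fix F G X Y Z assume "F \<in> Hom Q X Y" and "G \<in> Hom Q Y Z"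
  then obtain f g where "f \<in> Hom C X Y" "F = cls f" "g \<in> Hom C Y Z" "G = cls g"
    by (auto simp: Hom_Q)
  then show "G \<cdot>\<^bsub>Q\<^esub> F \<in> Hom Q X Z"
    using Comp_Q[of f X Y g Z] cls_in_Hom[OF Comp_closed[of f X Y g Z]] by simp
next
  fix F G H W X Y Z assume "F \<in> Hom Q W X" and "G \<in> Hom Q X Y" and "H \<in> Hom Q Y Z"
  then obtain f g h where f: "f \<in> Hom C W X" "F = cls f" and g: "g \<in> Hom C X Y" "G = cls g"
      and h: "h \<in> Hom C Y Z" "H = cls h"
    by (auto simp: Hom_Q)
  show "(H \<cdot>\<^bsub>Q\<^esub> G) \<cdot>\<^bsub>Q\<^esub> F = H \<cdot>\<^bsub>Q\<^esub> (G \<cdot>\<^bsub>Q\<^esub> F)"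
    using Comp_Q[OF f(1) g(1)] Comp_Q[OF g(1) h(1)] Comp_Q[OF f(1) Comp_closed[OF g(1) h(1)]]
      Comp_Q[OF Comp_closed[OF f(1) g(1)] h(1)] Comp_assoc[OF f(1) g(1) h(1)] f(2) g(2) h(2)
    by simp
next
  fix X assume "X \<in> Obj Q"
  then show "Ident Q X \<in> Hom Q X X" by (simp add: Ident_Q Ident_closed cls_in_Hom)
next
  fix F X Y assume "F \<in> Hom Q X Y"
  then obtain f where f: "f \<in> Hom C X Y" "F = cls f" by (rule Hom_Q_cases)
  have "X \<in> Obj C" "Y \<in> Obj C" using f Hom_Obj by auto
  then show "F \<cdot>\<^bsub>Q\<^esub> Ident Q X = F" and "Ident Q Y \<cdot>\<^bsub>Q\<^esub> F = F"
    using f Comp_Q[OF Ident_closed f(1)] Comp_Q[OF f(1) Ident_closed]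
    by (simp_all add: Ident_Q Comp_Ident[OF f(1)] Ident_Comp[OF f(1)])
qed

lemma preadditive_Q: "preadditive_category Q"
proof (intro preadditive_category.intro category_Q preadditive_category_axioms.intro)
  fix X Y assume XY: "X \<in> Obj Q" "Y \<in> Obj Q"
  then interpret H: abelian_group "hom_group C X Y" by (simp add: hom_abelian_group)
  show "abelian_group (hom_group Q X Y)"
  proof (rule abelian_groupI)
    fix F G H assume "F \<in> carrier (hom_group Q X Y)" "G \<in> carrier (hom_group Q X Y)"
      "H \<in> carrier (hom_group Q X Y)"
    then obtain f g h where f: "f \<in> Hom C X Y" "F = cls f" and g: "g \<in> Hom C X Y" "G = cls g"
      and h: "h \<in> Hom C X Y" "H = cls h"
      by (auto simp: Hom_Q)
    show "F \<oplus>\<^bsub>hom_group Q X Y\<^esub> G \<oplus>\<^bsub>hom_group Q X Y\<^esub> H =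
        F \<oplus>\<^bsub>hom_group Q X Y\<^esub> (G \<oplus>\<^bsub>hom_group Q X Y\<^esub> H)"
      using H.a_assoc[of f g h] f g h Add_Q[OF Add_closed[OF f(1) g(1)] h(1)]
        Add_Q[OF f(1) Add_closed[OF g(1) h(1)]]
      by (simp add: Add_Q[OF f(1) g(1)] Add_Q[OF g(1) h(1)])
  next
    fix F G assume "F \<in> carrier (hom_group Q X Y)" "G \<in> carrier (hom_group Q X Y)"
    then obtain f g where "f \<in> Hom C X Y" "F = cls f" "g \<in> Hom C X Y" "G = cls g"
      by (auto simp: Hom_Q)
    then show "F \<oplus>\<^bsub>hom_group Q X Y\<^esub> G \<in> carrier (hom_group Q X Y)"
      and "F \<oplus>\<^bsub>hom_group Q X Y\<^esub> G = G \<oplus>\<^bsub>hom_group Q X Y\<^esub> F"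
      using H.a_comm[of f g] by (simp_all add: Add_Q Add_closed cls_in_Hom)
  next
    show "\<zero>\<^bsub>hom_group Q X Y\<^esub> \<in> carrier (hom_group Q X Y)"
      using XY by (simp add: Zero_Q Zero_closed cls_in_Hom)
  next
    fix F assume "F \<in> carrier (hom_group Q X Y)"
    then obtain f where f: "f \<in> Hom C X Y" "F = cls f"
      by (auto simp: Hom_Q)
    then show "\<zero>\<^bsub>hom_group Q X Y\<^esub> \<oplus>\<^bsub>hom_group Q X Y\<^esub> F = F"
      using H.l_zero[of f] Add_Q[OF Zero_closed f(1)] XY by (simp add: Zero_Q)
    have "cls (\<ominus>\<^bsub>hom_group C X Y\<^esub> f) \<oplus>\<^bsub>hom_group Q X Y\<^esub> F = \<zero>\<^bsub>hom_group Q X Y\<^esub>"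
      using H.l_neg[of f] Add_Q[OF uminus_closed[OF f(1)] f(1)] f by (simp add: Zero_Q)
    then show "\<exists>G \<in> carrier (hom_group Q X Y). G \<oplus>\<^bsub>hom_group Q X Y\<^esub> F = \<zero>\<^bsub>hom_group Q X Y\<^esub>"
      using cls_in_Hom[OF uminus_closed[OF f(1)]] by (metis hom_group_simps(1))
  qed
next
  fix F G G' X Y Z assume "F \<in> Hom Q X Y" "G \<in> Hom Q Y Z" "G' \<in> Hom Q Y Z"
  then obtain f g g' where f: "f \<in> Hom C X Y" "F = cls f" and g: "g \<in> Hom C Y Z" "G = cls g"
      and g': "g' \<in> Hom C Y Z" "G' = cls g'"
    by (auto simp: Hom_Q)
  show "(G \<boxplus>\<^bsub>Q\<^esub> G') \<cdot>\<^bsub>Q\<^esub> F = (G \<cdot>\<^bsub>Q\<^esub> F) \<boxplus>\<^bsub>Q\<^esub> (G' \<cdot>\<^bsub>Q\<^esub> F)"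
    using Add_Q[OF g(1) g'(1)] Comp_Q[OF f(1) g(1)] Comp_Q[OF f(1) g'(1)]
      Comp_Q[OF f(1) Add_closed[OF g(1) g'(1)]] Comp_Add_left[OF f(1) g(1) g'(1)]
      Add_Q[OF Comp_closed[OF f(1) g(1)] Comp_closed[OF f(1) g'(1)]] f(2) g(2) g'(2)
    by simp
next
  fix F F' G X Y Z assume "F \<in> Hom Q X Y" "F' \<in> Hom Q X Y" "G \<in> Hom Q Y Z"
  then obtain f f' g where f: "f \<in> Hom C X Y" "F = cls f" and f': "f' \<in> Hom C X Y" "F' = cls f'"
      and g: "g \<in> Hom C Y Z" "G = cls g"
    by (auto simp: Hom_Q)
  show "G \<cdot>\<^bsub>Q\<^esub> (F \<boxplus>\<^bsub>Q\<^esub> F') = (G \<cdot>\<^bsub>Q\<^esub> F) \<boxplus>\<^bsub>Q\<^esub> (G \<cdot>\<^bsub>Q\<^esub> F')"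
    using Add_Q[OF f(1) f'(1)] Comp_Q[OF f(1) g(1)] Comp_Q[OF f'(1) g(1)]
      Comp_Q[OF Add_closed[OF f(1) f'(1)] g(1)] Comp_Add_right[OF f(1) f'(1) g(1)]
      Add_Q[OF Comp_closed[OF f(1) g(1)] Comp_closed[OF f'(1) g(1)]] f(2) f'(2) g(2)
    by simp
qed

text \<open>Direct sums in the quotient are the images of those in \<open>C\<close>.\<close>

lemma projection_additive: "additive_functor C Q \<lparr>omap = \<lambda>X. X, amap = cls\<rparr>"
  unfolding additive_functor_def is_functor_def
  by (auto simp: cls_in_Hom Ident_Q Comp_Q Add_Q)

lemma additive_Q: "additive_category Q"
proof (intro additive_category.intro preadditive_Q additive_category_axioms.intro)
  fix n :: nat and X :: "nat \<Rightarrow> 'o" assume "\<And>j. j < n \<Longrightarrow> X j \<in> Obj Q"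
  then obtain A i p where "is_direct_sum C n X A i p" using direct_sums[of n X] by auto
  from additive_functor_direct_sum[OF preadditive_category_axioms preadditive_Q
      projection_additive this]
  show "\<exists>A i p. is_direct_sum Q n X A i p" by auto
qed

end

lemma quotient_category_op:
  "quotient_category (op_cat C) S = op_cat (quotient_category C S)"
proof -
  have "factoring (op_cat C) S X Y = factoring C S Y X" for X Y
    unfolding factoring_def by auto
  then have "factoring_rel (op_cat C) S = factoring_rel C S"
    unfolding factoring_rel_def a_minus_op by auto
  then show ?thesis
    by (simp add: quotient_category_def Let_def op_cat_def) blast
qed

section \<open>Cokernels in the quotient\<close>

text \<open>The part of the triangulated structure that the construction of cokernels uses. A pair \<open>(r, c)\<close> in \<open>T\<close>
  stands for two consecutive morphisms \<open>E \<rightarrow> B \<rightarrow> D\<close> of a triangle that starts at an object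
  \<open>E = R\<^sup>n\<close>. Exactness of the triangle makes \<open>c\<close> a weak cokernel of \<open>r\<close> and \<open>r\<close> a weak kernel of \<open>c\<close>;
  rigidity of \<open>R\<close> enters as the lifting of morphisms \<open>R \<rightarrow> D\<close> along \<open>c\<close>, whose obstruction lies in
  \<open>Hom(R, \<Sigma> E) = 0\<close>; and the triangle can be pulled back along a morphism to \<open>D\<close> without changing \<open>E\<close>.
  These conditions also hold in the opposite category for the triangles that end at copies of a rigid
  object.\<close>

locale rigid_cones = additive_category C for C :: "('o, 'm, 'z) addcat_scheme" (structure) +
  fixes R :: 'o and T :: "('m \<times> 'm) set"
  assumes R_in_Obj: "R \<in> Obj C"
    and approximation: "A \<in> Obj C \<Longrightarrow>
      \<exists>E \<in> copies C R. \<exists>r \<in> Hom C E A. \<forall>x \<in> Hom C R A. \<exists>t \<in> Hom C R E. x = r \<cdot> t"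
    and cone_exists: "\<lbrakk>E \<in> copies C R; r \<in> Hom C E B\<rbrakk> \<Longrightarrow> \<exists>D. \<exists>c \<in> Hom C B D. (r, c) \<in> T"
    and source_copies: "\<lbrakk>(r, c) \<in> T; r \<in> Hom C E B\<rbrakk> \<Longrightarrow> E \<in> copies C R"
    and cone_zero: "\<lbrakk>(r, c) \<in> T; r \<in> Hom C E B; c \<in> Hom C B D\<rbrakk> \<Longrightarrow> c \<cdot> r = Zero C E D"
    and cone_weak_cokernel: "\<lbrakk>(r, c) \<in> T; r \<in> Hom C E B; c \<in> Hom C B D; g \<in> Hom C B W;
        g \<cdot> r = Zero C E W\<rbrakk> \<Longrightarrow> \<exists>h \<in> Hom C D W. g = h \<cdot> c"
    and cone_weak_kernel: "\<lbrakk>(r, c) \<in> T; r \<in> Hom C E B; c \<in> Hom C B D; x \<in> Hom C R B;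
        c \<cdot> x = Zero C R D\<rbrakk> \<Longrightarrow> \<exists>t \<in> Hom C R E. x = r \<cdot> t"
    and cone_lift: "\<lbrakk>(r, c) \<in> T; r \<in> Hom C E B; c \<in> Hom C B D; x \<in> Hom C R D\<rbrakk>
      \<Longrightarrow> \<exists>y \<in> Hom C R B. x = c \<cdot> y"
    and cone_base_change: "\<lbrakk>(r, c) \<in> T; r \<in> Hom C E B; c \<in> Hom C B D; g \<in> Hom C Y D\<rbrakk>
      \<Longrightarrow> \<exists>P. \<exists>r' \<in> Hom C E P. \<exists>c' \<in> Hom C P Y. \<exists>b \<in> Hom C P B.
        (r', c') \<in> T \<and> b \<cdot> r' = r \<and> c \<cdot> b = g \<cdot> c'"
begin

text \<open>Let \<open>r : E \<rightarrow> X\<close> be an approximation and \<open>c : X \<rightarrow> Z\<close> its cone. If \<open>f\<close> kills \<open>Hom(R, X)\<close> then it kills \<open>r\<close>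
  and so factors through \<open>Z\<close>. A morphism \<open>R \<rightarrow> Z\<close> lifts to \<open>X\<close>, hence factors through \<open>r\<close>, hence is
  zero in \<open>Z\<close>; so \<open>Z\<close> lies in the perpendicular subcategory.\<close>

lemma perp_detected:
  assumes XY: "X \<in> Obj C" "Y \<in> Obj C"
  shows "factoring C (perp_objects C R) X Y = {f \<in> Hom C X Y. \<forall>x \<in> Hom C R X. f \<cdot> x = Zero C R Y}"
    (is "?L = ?K")
proof (intro Set.equalityI subsetI)
  fix f assume "f \<in> ?L"
  then obtain Z a b where Z: "Hom C R Z = {Zero C R Z}" and a: "a \<in> Hom C X Z"
    and b: "b \<in> Hom C Z Y" and f: "f = b \<cdot> a"
    by (auto simp: factoring_def perp_objects_def)
  have "f \<cdot> x = Zero C R Y" if x: "x \<in> Hom C R X" for x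
    using Comp_assoc[OF x a b] Comp_closed[OF x a] Comp_Zero[OF b R_in_Obj] by (simp add: Z f)
  then show "f \<in> ?K" using Comp_closed[OF a b] f by simp
next
  fix f assume "f \<in> ?K"
  then have f: "f \<in> Hom C X Y" and f0: "\<And>x. x \<in> Hom C R X \<Longrightarrow> f \<cdot> x = Zero C R Y" by auto
  obtain E r where E: "E \<in> copies C R" and r: "r \<in> Hom C E X"
    and cover: "\<And>x. x \<in> Hom C R X \<Longrightarrow> \<exists>t \<in> Hom C R E. x = r \<cdot> t"
    using approximation[OF XY(1)] by metis
  obtain Z c where c: "c \<in> Hom C X Z" and T: "(r, c) \<in> T" using cone_exists[OF E r] by blast
  have EO: "E \<in> Obj C" and ZO: "Z \<in> Obj C" using Hom_Obj r c by auto
  have "f \<cdot> r = Zero C E Y"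
  proof (rule copies_ext[OF E Comp_closed[OF r f] Zero_closed[OF EO XY(2)]])
    fix t assume t: "t \<in> Hom C R E"
    show "(f \<cdot> r) \<cdot> t = Zero C E Y \<cdot> t"
      using Comp_assoc[OF t r f] f0[OF Comp_closed[OF t r]] Zero_Comp[OF t XY(2)] by simp
  qed
  then obtain h where h: "h \<in> Hom C Z Y" "f = h \<cdot> c"
    using cone_weak_cokernel[OF T r c f] by blast
  have "x = Zero C R Z" if x: "x \<in> Hom C R Z" for x
  proof -
    obtain y where y: "y \<in> Hom C R X" "x = c \<cdot> y" using cone_lift[OF T r c x] by blast
    obtain t where t: "t \<in> Hom C R E" "y = r \<cdot> t" using cover[OF y(1)] by blast
    show ?thesis
      using Comp_assoc[OF t(1) r c] cone_zero[OF T r c] Zero_Comp[OF t(1) ZO] t(2) y(2) by simp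
  qed
  then have "Z \<in> perp_objects C R"
    using ZO Zero_closed[OF R_in_Obj ZO] unfolding perp_objects_def by blast
  then show "f \<in> ?L" using c h by (auto simp: factoring_def)
qed

sublocale detected_quotient C "perp_objects C R" R
  by unfold_locales (simp_all add: R_in_Obj perp_detected)

sublocale Q: additive_category Q
  by (rule additive_Q)

text \<open>So \<open>Hom C R\<close> is represented by \<open>R\<close> also in the quotient; test with the identity of \<open>R\<close>.\<close>

lemma cls_inject_on_R:
  assumes "f \<in> Hom C R Y" and "g \<in> Hom C R Y" and "cls f = cls g"
  shows "f = g"
  using assms cls_eq_iff[OF assms(1,2)] Ident_closed[OF R_Obj] Comp_Ident by metis

text \<open>Every morphism from \<open>R\<close> to \<open>D\<close> lifts along \<open>c\<close>.\<close>

lemma cone_epi: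
  assumes T: "(r, c) \<in> T" and r: "r \<in> Hom C E B" and c: "c \<in> Hom C B D"
    and H: "H \<in> Hom Q D W" and H': "H' \<in> Hom Q D W"
    and eq: "H \<cdot>\<^bsub>Q\<^esub> cls c = H' \<cdot>\<^bsub>Q\<^esub> cls c"
  shows "H = H'"
proof -
  obtain h h' where h: "h \<in> Hom C D W" "H = cls h" and h': "h' \<in> Hom C D W" "H' = cls h'"
    using H H' by (auto simp: Hom_Q)
  have hc: "(h \<cdot> c) \<cdot> y = (h' \<cdot> c) \<cdot> y" if "y \<in> Hom C R B" for y
    using that eq Comp_Q[OF c h(1)] Comp_Q[OF c h'(1)] h(2) h'(2)
      cls_eq_iff[OF Comp_closed[OF c h(1)] Comp_closed[OF c h'(1)]] by simp
  have "h \<cdot> x = h' \<cdot> x" if x: "x \<in> Hom C R D" for x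
  proof -
    obtain y where y: "y \<in> Hom C R B" "x = c \<cdot> y" using cone_lift[OF T r c x] by blast
    show ?thesis using Comp_assoc[OF y(1) c h(1)] Comp_assoc[OF y(1) c h'(1)] hc[OF y(1)] y(2) by simp
  qed
  then show ?thesis using cls_eq_iff[OF h(1) h'(1)] h(2) h'(2) by blast
qed

text \<open>The weak cokernel \<open>c\<close> of \<open>r\<close> becomes a cokernel in the quotient, where it is an epimorphism. An
  equation \<open>g \<cdot> r = 0\<close> in the quotient already holds in \<open>C\<close>, since the source \<open>E\<close> is a sum of copies of \<open>R\<close>.\<close>

lemma cone_cokernel_factor:
  assumes T: "(r, c) \<in> T" and r: "r \<in> Hom C E B" and c: "c \<in> Hom C B D"
    and G: "G \<in> Hom Q B W" and G0: "G \<cdot>\<^bsub>Q\<^esub> cls r = Zero Q E W"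
  shows "\<exists>!H. H \<in> Hom Q D W \<and> H \<cdot>\<^bsub>Q\<^esub> cls c = G"
proof -
  obtain g where g: "g \<in> Hom C B W" "G = cls g" using G by (auto simp: Hom_Q)
  have EW: "E \<in> Obj C" "W \<in> Obj C" using r g Hom_Obj by auto
  have "cls (g \<cdot> r) = cls (Zero C E W)" using G0 Comp_Q[OF r g(1)] g(2) by (simp add: Zero_Q)
  then have "g \<cdot> r = Zero C E W"
    using cls_eq_iff[OF Comp_closed[OF r g(1)] Zero_closed[OF EW]]
    by (intro copies_ext[OF source_copies[OF T r] Comp_closed[OF r g(1)] Zero_closed[OF EW]]) blast
  then obtain h where h: "h \<in> Hom C D W" "g = h \<cdot> c"
    using cone_weak_cokernel[OF T r c g(1)] by blast
  show ?thesis
  proof (rule ex1I[of _ "cls h"])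
    show "cls h \<in> Hom Q D W \<and> cls h \<cdot>\<^bsub>Q\<^esub> cls c = G"
      using h g(2) Comp_Q[OF c h(1)] cls_in_Hom[OF h(1)] by simp
    then show "H = cls h" if "H \<in> Hom Q D W \<and> H \<cdot>\<^bsub>Q\<^esub> cls c = G" for H
      using that cone_epi[OF T r c, of H W "cls h"] by simp
  qed
qed

text \<open>A morphism from \<open>B\<close> kills \<open>f : A \<rightarrow> B\<close> in the quotient iff it kills \<open>f \<cdot> r\<close>, where \<open>r : E \<rightarrow> A\<close> is an
  approximation. So the cone of \<open>f \<cdot> r\<close> is a cokernel of \<open>f\<close>.\<close>

lemma cokernel_is_cone:
  assumes F: "F \<in> Hom Q A B"
  obtains E r D c where "(r, c) \<in> T" and "r \<in> Hom C E B" and "c \<in> Hom C B D"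
    and "is_cokernel Q F (cls c)"
proof -
  obtain f where f: "f \<in> Hom C A B" "F = cls f" using F by (auto simp: Hom_Q)
  have AO: "A \<in> Obj C" using f Hom_Obj by auto
  obtain E r where E: "E \<in> copies C R" and r: "r \<in> Hom C E A"
    and cover: "\<And>x. x \<in> Hom C R A \<Longrightarrow> \<exists>t \<in> Hom C R E. x = r \<cdot> t"
    using approximation[OF AO] by metis
  have fr: "f \<cdot> r \<in> Hom C E B" by (rule Comp_closed[OF r f(1)])
  obtain D c where c: "c \<in> Hom C B D" and T: "(f \<cdot> r, c) \<in> T" using cone_exists[OF E fr] by blast
  have DO: "D \<in> Obj C" using c Hom_Obj by auto
  have "(c \<cdot> f) \<cdot> x = Zero C A D \<cdot> x" if x: "x \<in> Hom C R A" for x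
  proof -
    obtain t where t: "t \<in> Hom C R E" "x = r \<cdot> t" using cover[OF x] by blast
    have "(c \<cdot> f) \<cdot> x = (c \<cdot> (f \<cdot> r)) \<cdot> t"
      using Comp_assoc[OF x f(1) c] Comp_assoc[OF t(1) r f(1)] Comp_assoc[OF t(1) fr c] t(2) by simp
    also have "\<dots> = Zero C R D" using cone_zero[OF T fr c] Zero_Comp[OF t(1) DO] by simp
    finally show ?thesis using Zero_Comp[OF x DO] by simp
  qed
  then have zero: "cls c \<cdot>\<^bsub>Q\<^esub> F = Zero Q A D"
    using cls_eq_iff[OF Comp_closed[OF f(1) c] Zero_closed[OF AO DO]] Comp_Q[OF f(1) c] f(2)
    by (simp add: Zero_Q)
  have "\<exists>!H. H \<in> Hom Q D W \<and> H \<cdot>\<^bsub>Q\<^esub> cls c = G"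
    if G: "G \<in> Hom Q B W" and G0: "G \<cdot>\<^bsub>Q\<^esub> F = Zero Q A W" for G W
  proof (rule cone_cokernel_factor[OF T fr c G])
    have "W \<in> Obj Q" using Q.Hom_Obj[OF G] by simp
    then show "G \<cdot>\<^bsub>Q\<^esub> cls (f \<cdot> r) = Zero Q E W"
      using Q.Comp_assoc[OF cls_in_Hom[OF r] F G] Comp_Q[OF r f(1)] f(2) G0
        Q.Zero_Comp[OF cls_in_Hom[OF r]] by simp
  qed
  then have "is_cokernel Q F (cls c)"
    unfolding is_cokernel_def using F cls_in_Hom[OF c] zero by blast
  then show thesis by (rule that[OF T fr c])
qed

text \<open>The triangle over \<open>Y\<close> is a weak pullback as seen from \<open>R\<close>: lift \<open>e\<close> to \<open>y0\<close>; the error \<open>b \<cdot> y0 - a\<close> is killed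
  by \<open>c\<close>, so it is \<open>r \<cdot> t\<close> for some \<open>t\<close>, and \<open>y0 - r' \<cdot> t\<close> solves both equations.\<close>

lemma base_change_lift:
  assumes T: "(r, c) \<in> T" and r: "r \<in> Hom C E B" and c: "c \<in> Hom C B D"
    and T': "(r', c') \<in> T" and r': "r' \<in> Hom C E P" and c': "c' \<in> Hom C P Y"
    and b: "b \<in> Hom C P B" and g: "g \<in> Hom C Y D"
    and br: "b \<cdot> r' = r" and cb: "c \<cdot> b = g \<cdot> c'"
    and a: "a \<in> Hom C R B" and e: "e \<in> Hom C R Y" and ae: "c \<cdot> a = g \<cdot> e"
  shows "\<exists>y \<in> Hom C R P. b \<cdot> y = a \<and> c' \<cdot> y = e"
proof -
  obtain y0 where y0: "y0 \<in> Hom C R P" "e = c' \<cdot> y0" using cone_lift[OF T' r' c' e] by blast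
  have by0: "b \<cdot> y0 \<in> Hom C R B" by (rule Comp_closed[OF y0(1) b])
  have "c \<cdot> (b \<cdot> y0) = c \<cdot> a"
    using Comp_assoc[OF y0(1) b c] Comp_assoc[OF y0(1) c' g] cb ae y0(2) by simp
  then have "c \<cdot> (b \<cdot> y0 \<ominus>\<^bsub>hom_group C R B\<^esub> a) = Zero C R D"
    using Comp_minus_right[OF by0 a c] minus_eq_Zero_iff[OF Comp_closed[OF a c] Comp_closed[OF a c]]
    by simp
  then obtain t where t: "t \<in> Hom C R E" "b \<cdot> y0 \<ominus>\<^bsub>hom_group C R B\<^esub> a = r \<cdot> t"
    using cone_weak_kernel[OF T r c minus_closed[OF by0 a]] by blast
  have rt: "r' \<cdot> t \<in> Hom C R P" by (rule Comp_closed[OF t(1) r'])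
  define y where "y = y0 \<ominus>\<^bsub>hom_group C R P\<^esub> r' \<cdot> t"
  have "y \<in> Hom C R P" unfolding y_def by (rule minus_closed[OF y0(1) rt])
  moreover have "b \<cdot> y = a"
    using Comp_minus_right[OF y0(1) rt b] Comp_assoc[OF t(1) r' b] br t(2)
      minus_minus_cancel[OF by0 a] by (simp add: y_def)
  moreover have "c' \<cdot> y = e"
  proof -
    have YO: "Y \<in> Obj C" using e Hom_Obj by auto
    have "c' \<cdot> (r' \<cdot> t) = Zero C R Y"
      using Comp_assoc[OF t(1) r' c'] cone_zero[OF T' r' c'] Zero_Comp[OF t(1) YO] by simp
    moreover have "e \<ominus>\<^bsub>hom_group C R Y\<^esub> Zero C R Y = e"
      using minus_minus_cancel[OF e e] minus_eq_Zero_iff[OF e e] by simp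
    ultimately show ?thesis using Comp_minus_right[OF y0(1) rt c'] y0(2) by (simp add: y_def)
  qed
  ultimately show ?thesis by blast
qed

text \<open>Up to an isomorphism of its target, \<open>F\<close> is the second morphism \<open>c\<close> of a triangle \<open>E \<rightarrow> X \<rightarrow> D\<close>. Changing
  the base of this triangle along \<open>G\<close> gives a triangle \<open>E \<rightarrow> P' \<rightarrow> Y\<close>, whose second morphism \<open>c'\<close> is a
  cokernel. The object \<open>P'\<close> need not be a pullback in the quotient, but it maps to the pullback \<open>P\<close> by
  some \<open>s\<close> over \<open>X\<close> and \<open>Y\<close>. As \<open>P'\<close> is a weak pullback as seen from \<open>R\<close>, every morphism \<open>R \<rightarrow> P\<close> factors
  through \<open>s\<close>, and \<open>s\<close> is an epimorphism. Since \<open>q \<cdot> s = c'\<close> is a cokernel of \<open>r'\<close>, it follows that \<open>q\<close> is a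
  cokernel of \<open>s \<cdot> r'\<close>.\<close>

lemma cokernels_pullback_stable:
  assumes pb: "is_pullback Q F G p q" and coker: "is_cokernel Q K F"
  shows "\<exists>L. is_cokernel Q L q"
proof -
  obtain P X Y Z where F: "F \<in> Hom Q X Z" and G: "G \<in> Hom Q Y Z" and p: "p \<in> Hom Q P X"
    and q: "q \<in> Hom Q P Y" and Fp: "F \<cdot>\<^bsub>Q\<^esub> p = G \<cdot>\<^bsub>Q\<^esub> q"
    and univ: "\<forall>W. \<forall>a \<in> Hom Q W X. \<forall>b \<in> Hom Q W Y. F \<cdot>\<^bsub>Q\<^esub> a = G \<cdot>\<^bsub>Q\<^esub> b \<longrightarrow>
       (\<exists>!h. h \<in> Hom Q W P \<and> p \<cdot>\<^bsub>Q\<^esub> h = a \<and> q \<cdot>\<^bsub>Q\<^esub> h = b)"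
    using pb unfolding is_pullback_def by (elim exE conjE) (rule that)
  obtain A X' Z' where K': "K \<in> Hom Q A X'" and F': "F \<in> Hom Q X' Z'"
    and FK': "F \<cdot>\<^bsub>Q\<^esub> K = Zero Q A Z'"
    and cok': "\<forall>W. \<forall>g \<in> Hom Q X' W. g \<cdot>\<^bsub>Q\<^esub> K = Zero Q A W \<longrightarrow>
       (\<exists>!h. h \<in> Hom Q Z' W \<and> h \<cdot>\<^bsub>Q\<^esub> F = g)"
    using coker unfolding is_cokernel_def by (elim exE conjE) (rule that)
  have eqs: "X' = X" "Z' = Z" using Q.Hom_disjoint[OF F' F] by auto
  note K = K'[unfolded eqs] and FK = FK'[unfolded eqs] and cok = cok'[unfolded eqs, rule_format]
  obtain E r D c where T: "(r, c) \<in> T" and r: "r \<in> Hom C E X" and c: "c \<in> Hom C X D"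
    and ck: "is_cokernel Q K (cls c)"
    by (rule cokernel_is_cone[OF K])
  have ZO: "Z \<in> Obj Q" using F Q.Hom_Obj by blast
  obtain A2 X2 D2 where K2: "K \<in> Hom Q A2 X2" and c2: "cls c \<in> Hom Q X2 D2"
    and ck2: "cls c \<cdot>\<^bsub>Q\<^esub> K = Zero Q A2 D2"
    and cuniv2: "\<forall>W. \<forall>g \<in> Hom Q X2 W. g \<cdot>\<^bsub>Q\<^esub> K = Zero Q A2 W \<longrightarrow>
       (\<exists>!h. h \<in> Hom Q D2 W \<and> h \<cdot>\<^bsub>Q\<^esub> cls c = g)"
    using ck unfolding is_cokernel_def by (elim exE conjE) (rule that)
  have eqs2: "A2 = A" "X2 = X" "D2 = D"
    using Q.Hom_disjoint[OF K2 K] Q.Hom_disjoint[OF c2 cls_in_Hom[OF c]] by auto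
  \<comment> \<open>\<open>U\<close> and \<open>V\<close> compare the two cokernels \<open>F\<close> and \<open>cls c\<close> of \<open>K\<close>.\<close>
  obtain V where V: "V \<in> Hom Q Z D" "V \<cdot>\<^bsub>Q\<^esub> F = cls c"
    using cok[OF cls_in_Hom[OF c] ck2[unfolded eqs2]] by blast
  obtain U where U: "U \<in> Hom Q D Z" "U \<cdot>\<^bsub>Q\<^esub> cls c = F"
    using cuniv2[unfolded eqs2, rule_format, OF F FK] by blast
  have UV: "U \<cdot>\<^bsub>Q\<^esub> V = Ident Q Z"
  proof -
    have "(U \<cdot>\<^bsub>Q\<^esub> V) \<cdot>\<^bsub>Q\<^esub> F = F" using Q.Comp_assoc[OF F V(1) U(1)] V(2) U(2) by simp
    moreover have "\<exists>!h. h \<in> Hom Q Z Z \<and> h \<cdot>\<^bsub>Q\<^esub> F = F" by (rule cok[OF F FK])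
    ultimately show ?thesis
      using Q.Comp_closed[OF V(1) U(1)] Q.Ident_closed[OF ZO] Q.Ident_Comp[OF F] by blast
  qed
  obtain g where g: "g \<in> Hom C Y D" "V \<cdot>\<^bsub>Q\<^esub> G = cls g"
    using Q.Comp_closed[OF G V(1)] by (auto simp: Hom_Q)
  obtain P' r' c' b where r': "r' \<in> Hom C E P'" and c': "c' \<in> Hom C P' Y" and b: "b \<in> Hom C P' X"
    and T': "(r', c') \<in> T" and br: "b \<cdot> r' = r" and cb: "c \<cdot> b = g \<cdot> c'"
    using cone_base_change[OF T r c g(1)] by blast
  note Qb = cls_in_Hom[OF b] and Qc = cls_in_Hom[OF c] and Qc' = cls_in_Hom[OF c']
    and Qr' = cls_in_Hom[OF r'] and Qg = cls_in_Hom[OF g(1)]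
  have "F \<cdot>\<^bsub>Q\<^esub> cls b = U \<cdot>\<^bsub>Q\<^esub> (cls c \<cdot>\<^bsub>Q\<^esub> cls b)" using Q.Comp_assoc[OF Qb Qc U(1)] U(2) by simp
  also have "\<dots> = U \<cdot>\<^bsub>Q\<^esub> (cls g \<cdot>\<^bsub>Q\<^esub> cls c')" using Comp_Q[OF b c] Comp_Q[OF c' g(1)] cb by simp
  also have "\<dots> = U \<cdot>\<^bsub>Q\<^esub> (V \<cdot>\<^bsub>Q\<^esub> (G \<cdot>\<^bsub>Q\<^esub> cls c'))" using Q.Comp_assoc[OF Qc' G V(1)] g(2) by simp
  also have "\<dots> = G \<cdot>\<^bsub>Q\<^esub> cls c'"
    using Q.Comp_assoc[OF Q.Comp_closed[OF Qc' G] V(1) U(1)] UV Q.Ident_Comp[OF Q.Comp_closed[OF Qc' G]]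
    by simp
  finally obtain s where s: "s \<in> Hom Q P' P" and ps: "p \<cdot>\<^bsub>Q\<^esub> s = cls b" and qs: "q \<cdot>\<^bsub>Q\<^esub> s = cls c'"
    using univ[rule_format, OF Qb Qc'] by blast
  have lift: "\<exists>y \<in> Hom C R P'. \<xi> = s \<cdot>\<^bsub>Q\<^esub> cls y" if \<xi>: "\<xi> \<in> Hom Q R P" for \<xi>
  proof -
    obtain a where a: "a \<in> Hom C R X" "p \<cdot>\<^bsub>Q\<^esub> \<xi> = cls a"
      using Q.Comp_closed[OF \<xi> p] by (auto simp: Hom_Q)
    obtain e where e: "e \<in> Hom C R Y" "q \<cdot>\<^bsub>Q\<^esub> \<xi> = cls e"
      using Q.Comp_closed[OF \<xi> q] by (auto simp: Hom_Q)
    have "cls c \<cdot>\<^bsub>Q\<^esub> cls a = V \<cdot>\<^bsub>Q\<^esub> (F \<cdot>\<^bsub>Q\<^esub> cls a)"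
      using Q.Comp_assoc[OF cls_in_Hom[OF a(1)] F V(1)] V(2) by simp
    also have Fa: "F \<cdot>\<^bsub>Q\<^esub> cls a = G \<cdot>\<^bsub>Q\<^esub> cls e"
      using Q.Comp_assoc[OF \<xi> p F] Q.Comp_assoc[OF \<xi> q G] Fp a(2) e(2) by simp
    also have "V \<cdot>\<^bsub>Q\<^esub> (G \<cdot>\<^bsub>Q\<^esub> cls e) = cls g \<cdot>\<^bsub>Q\<^esub> cls e"
      using Q.Comp_assoc[OF cls_in_Hom[OF e(1)] G V(1)] g(2) by simp
    finally have "cls (c \<cdot> a) = cls (g \<cdot> e)" using Comp_Q[OF a(1) c] Comp_Q[OF e(1) g(1)] by simp
    then have "c \<cdot> a = g \<cdot> e"
      by (rule cls_inject_on_R[OF Comp_closed[OF a(1) c] Comp_closed[OF e(1) g(1)]])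
    then obtain y where y: "y \<in> Hom C R P'" "b \<cdot> y = a" "c' \<cdot> y = e"
      using base_change_lift[OF T r c T' r' c' b g(1) br cb a(1) e(1)] by blast
    note Qy = cls_in_Hom[OF y(1)]
    have "p \<cdot>\<^bsub>Q\<^esub> (s \<cdot>\<^bsub>Q\<^esub> cls y) = cls a" "q \<cdot>\<^bsub>Q\<^esub> (s \<cdot>\<^bsub>Q\<^esub> cls y) = cls e"
      using Q.Comp_assoc[OF Qy s p] Q.Comp_assoc[OF Qy s q] ps qs Comp_Q[OF y(1) b]
        Comp_Q[OF y(1) c'] y(2,3) by simp_all
    then have "\<xi> = s \<cdot>\<^bsub>Q\<^esub> cls y"
      using univ[rule_format, OF cls_in_Hom[OF a(1)] cls_in_Hom[OF e(1)] Fa] \<xi> a(2) e(2) Q.Comp_closed[OF Qy s]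
      by blast
    then show ?thesis using y(1) by blast
  qed
  have s_epi: "H = H'"
    if H: "H \<in> Hom Q P W" and H': "H' \<in> Hom Q P W" and eq: "H \<cdot>\<^bsub>Q\<^esub> s = H' \<cdot>\<^bsub>Q\<^esub> s" for H H' W
  proof -
    obtain h h' where h: "h \<in> Hom C P W" "H = cls h" and h': "h' \<in> Hom C P W" "H' = cls h'"
      using H H' by (auto simp: Hom_Q)
    have "h \<cdot> x = h' \<cdot> x" if x: "x \<in> Hom C R P" for x
    proof -
      obtain y where y: "y \<in> Hom C R P'" "cls x = s \<cdot>\<^bsub>Q\<^esub> cls y" using lift[OF cls_in_Hom[OF x]] by blast
      have "cls h \<cdot>\<^bsub>Q\<^esub> cls x = cls h' \<cdot>\<^bsub>Q\<^esub> cls x"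
        using Q.Comp_assoc[OF cls_in_Hom[OF y(1)] s H] Q.Comp_assoc[OF cls_in_Hom[OF y(1)] s H'] eq
          y(2) h(2) h'(2) by simp
      then have "cls (h \<cdot> x) = cls (h' \<cdot> x)" using Comp_Q[OF x h(1)] Comp_Q[OF x h'(1)] by simp
      then show ?thesis
        by (rule cls_inject_on_R[OF Comp_closed[OF x h(1)] Comp_closed[OF x h'(1)]])
    qed
    then show ?thesis using cls_eq_iff[OF h(1) h'(1)] h(2) h'(2) by blast
  qed
  have sr: "s \<cdot>\<^bsub>Q\<^esub> cls r' \<in> Hom Q E P" by (rule Q.Comp_closed[OF Qr' s])
  have qsr: "q \<cdot>\<^bsub>Q\<^esub> (s \<cdot>\<^bsub>Q\<^esub> cls r') = Zero Q E Y"
    using Q.Comp_assoc[OF Qr' s q] qs Comp_Q[OF r' c'] cone_zero[OF T' r' c'] by (simp add: Zero_Q)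
  have fac: "\<exists>!H. H \<in> Hom Q Y W \<and> H \<cdot>\<^bsub>Q\<^esub> q = M"
    if M: "M \<in> Hom Q P W" and M0: "M \<cdot>\<^bsub>Q\<^esub> (s \<cdot>\<^bsub>Q\<^esub> cls r') = Zero Q E W" for M W
  proof -
    note Ms = Q.Comp_closed[OF s M]
    have "(M \<cdot>\<^bsub>Q\<^esub> s) \<cdot>\<^bsub>Q\<^esub> cls r' = Zero Q E W" using Q.Comp_assoc[OF Qr' s M] M0 by simp
    then obtain H where H: "H \<in> Hom Q Y W" "H \<cdot>\<^bsub>Q\<^esub> cls c' = M \<cdot>\<^bsub>Q\<^esub> s"
      using cone_cokernel_factor[OF T' r' c' Ms] by blast
    have "(H \<cdot>\<^bsub>Q\<^esub> q) \<cdot>\<^bsub>Q\<^esub> s = M \<cdot>\<^bsub>Q\<^esub> s" using Q.Comp_assoc[OF s q H(1)] qs H(2) by simp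
    then have Hq: "H \<cdot>\<^bsub>Q\<^esub> q = M" by (rule s_epi[OF Q.Comp_closed[OF q H(1)] M])
    show ?thesis
    proof (rule ex1I[of _ H])
      fix H' assume H': "H' \<in> Hom Q Y W \<and> H' \<cdot>\<^bsub>Q\<^esub> q = M"
      then have "H' \<cdot>\<^bsub>Q\<^esub> cls c' = H \<cdot>\<^bsub>Q\<^esub> cls c'"
        using Q.Comp_assoc[OF s q, of H' W] H(2) qs by simp
      then show "H' = H" using cone_epi[OF T' r' c', of H' W H] H' H(1) by blast
    qed (use H(1) Hq in blast)
  qed
  have "is_cokernel Q (s \<cdot>\<^bsub>Q\<^esub> cls r') q"
    unfolding is_cokernel_def using sr q qsr fac by blast
  then show ?thesis by blast
qed

end

section \<open>Equivalences\<close>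

lemma (in category) is_isoE:
  assumes "is_iso C f" and "f \<in> Hom C X Y"
  obtains g where "g \<in> Hom C Y X" and "g \<cdot> f = Ident C X" and "f \<cdot> g = Ident C Y"
proof -
  obtain X' Y' g where f: "f \<in> Hom C X' Y'" and g: "g \<in> Hom C Y' X'"
    and gf: "g \<cdot> f = Ident C X'" and fg: "f \<cdot> g = Ident C Y'"
    using assms(1) unfolding is_iso_def by (elim exE conjE) (rule that)
  have eqs: "X' = X" "Y' = Y" using Hom_disjoint[OF f assms(2)] by auto
  show thesis by (rule that[OF g[unfolded eqs] gf[unfolded eqs] fg[unfolded eqs]])
qed

lemma is_functorD:
  assumes "is_functor C D F"
  shows "X \<in> Obj C \<Longrightarrow> omap F X \<in> Obj D"
    and "f \<in> Hom C X Y \<Longrightarrow> amap F f \<in> Hom D (omap F X) (omap F Y)"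
    and "X \<in> Obj C \<Longrightarrow> amap F (Ident C X) = Ident D (omap F X)"
    and "\<lbrakk>f \<in> Hom C X Y; g \<in> Hom C Y Z\<rbrakk> \<Longrightarrow> amap F (g \<cdot>\<^bsub>C\<^esub> f) = amap F g \<cdot>\<^bsub>D\<^esub> amap F f"
  using assms unfolding is_functor_def by blast+

lemma natural_isoD:
  assumes "natural_iso C D F G \<eta>"
  shows "X \<in> Obj C \<Longrightarrow> \<eta> X \<in> Hom D (omap F X) (omap G X)"
    and "X \<in> Obj C \<Longrightarrow> is_iso D (\<eta> X)"
    and "f \<in> Hom C X Y \<Longrightarrow> \<eta> Y \<cdot>\<^bsub>D\<^esub> amap F f = amap G f \<cdot>\<^bsub>D\<^esub> \<eta> X"
  using assms unfolding natural_iso_def by blast+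

locale category_equivalence = C: category C + D: category D
  for C :: "('o, 'm, 'y) cat_scheme" and D :: "('p, 'n, 'z) cat_scheme" +
  fixes F :: "('o, 'm, 'p, 'n) fctr"
  assumes equivalence: "is_equivalence C D F"
begin

lemma F_functor: "is_functor C D F"
  using equivalence by (simp add: is_equivalence_def)

text \<open>The unit \<open>\<eta> Y\<close> is invertible and \<open>\<eta> Y \<cdot> f\<close> depends on \<open>amap F f\<close> only.\<close>

lemma faithful:
  assumes f: "f \<in> Hom C X Y" and g: "g \<in> Hom C X Y" and eq: "amap F f = amap F g"
  shows "f = g"
proof -
  obtain G \<eta> where \<eta>: "natural_iso C C id_fctr (comp_fctr G F) \<eta>"
    using equivalence unfolding is_equivalence_def by blast
  have XY: "X \<in> Obj C" "Y \<in> Obj C" using f C.Hom_Obj by auto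
  have \<eta>Y: "\<eta> Y \<in> Hom C Y (omap G (omap F Y))"
    using natural_isoD(1)[OF \<eta> XY(2)] by (simp add: id_fctr_def comp_fctr_def)
  obtain u where u: "u \<in> Hom C (omap G (omap F Y)) Y" "u \<cdot>\<^bsub>C\<^esub> \<eta> Y = Ident C Y"
    by (rule C.is_isoE[OF natural_isoD(2)[OF \<eta> XY(2)] \<eta>Y])
  have "\<eta> Y \<cdot>\<^bsub>C\<^esub> f = \<eta> Y \<cdot>\<^bsub>C\<^esub> g"
    using natural_isoD(3)[OF \<eta> f] natural_isoD(3)[OF \<eta> g] eq
    by (simp add: id_fctr_def comp_fctr_def)
  then have "(u \<cdot>\<^bsub>C\<^esub> \<eta> Y) \<cdot>\<^bsub>C\<^esub> f = (u \<cdot>\<^bsub>C\<^esub> \<eta> Y) \<cdot>\<^bsub>C\<^esub> g"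
    using C.Comp_assoc[OF f \<eta>Y u(1)] C.Comp_assoc[OF g \<eta>Y u(1)] by simp
  then show ?thesis using u(2) C.Ident_Comp[OF f] C.Ident_Comp[OF g] by simp
qed

text \<open>The preimage of \<open>g\<close> is the conjugate of \<open>amap G g\<close> by the unit. By naturality of the unit, the functor
  \<open>G\<close> takes the same value on \<open>amap F f\<close> and \<open>g\<close>; by naturality of the counit it is faithful.\<close>

lemma full:
  assumes XY: "X \<in> Obj C" "Y \<in> Obj C" and g: "g \<in> Hom D (omap F X) (omap F Y)"
  shows "\<exists>f \<in> Hom C X Y. amap F f = g"
proof -
  obtain G \<eta> \<epsilon> where G: "is_functor D C G" and \<eta>: "natural_iso C C id_fctr (comp_fctr G F) \<eta>"
    and \<epsilon>: "natural_iso D D (comp_fctr F G) id_fctr \<epsilon>"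
    using equivalence unfolding is_equivalence_def by blast
  let ?GX = "omap G (omap F X)" and ?GY = "omap G (omap F Y)"
  have \<eta>X: "\<eta> X \<in> Hom C X ?GX" and \<eta>Y: "\<eta> Y \<in> Hom C Y ?GY"
    using natural_isoD(1)[OF \<eta>] XY by (simp_all add: id_fctr_def comp_fctr_def)
  obtain u where u: "u \<in> Hom C ?GY Y" "\<eta> Y \<cdot>\<^bsub>C\<^esub> u = Ident C ?GY"
    by (rule C.is_isoE[OF natural_isoD(2)[OF \<eta> XY(2)] \<eta>Y])
  obtain x where x: "x \<in> Hom C ?GX X" "\<eta> X \<cdot>\<^bsub>C\<^esub> x = Ident C ?GX"
    by (rule C.is_isoE[OF natural_isoD(2)[OF \<eta> XY(1)] \<eta>X])
  have Gg: "amap G g \<in> Hom C ?GX ?GY" by (rule is_functorD(2)[OF G g])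
  note Gg\<eta> = C.Comp_closed[OF \<eta>X Gg]
  define f where "f = u \<cdot>\<^bsub>C\<^esub> (amap G g \<cdot>\<^bsub>C\<^esub> \<eta> X)"
  have f: "f \<in> Hom C X Y" unfolding f_def by (rule C.Comp_closed[OF Gg\<eta> u(1)])
  have Ff: "amap F f \<in> Hom D (omap F X) (omap F Y)" by (rule is_functorD(2)[OF F_functor f])
  have GFf: "amap G (amap F f) \<in> Hom C ?GX ?GY" by (rule is_functorD(2)[OF G Ff])
  have "amap G (amap F f) \<cdot>\<^bsub>C\<^esub> \<eta> X = \<eta> Y \<cdot>\<^bsub>C\<^esub> f"
    using natural_isoD(3)[OF \<eta> f] by (simp add: id_fctr_def comp_fctr_def)
  also have "\<dots> = amap G g \<cdot>\<^bsub>C\<^esub> \<eta> X"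
    using C.Comp_assoc[OF Gg\<eta> u(1) \<eta>Y] u(2) C.Ident_Comp[OF Gg\<eta>] by (simp add: f_def)
  finally have "(amap G (amap F f) \<cdot>\<^bsub>C\<^esub> \<eta> X) \<cdot>\<^bsub>C\<^esub> x = (amap G g \<cdot>\<^bsub>C\<^esub> \<eta> X) \<cdot>\<^bsub>C\<^esub> x" by simp
  then have GG: "amap G (amap F f) = amap G g"
    using C.Comp_assoc[OF x(1) \<eta>X GFf] C.Comp_assoc[OF x(1) \<eta>X Gg] x(2)
      C.Comp_Ident[OF GFf] C.Comp_Ident[OF Gg] by simp
  have FX: "omap F X \<in> Obj D" by (rule is_functorD(1)[OF F_functor XY(1)])
  have \<epsilon>X: "\<epsilon> (omap F X) \<in> Hom D (omap F ?GX) (omap F X)"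
    using natural_isoD(1)[OF \<epsilon> FX] by (simp add: id_fctr_def comp_fctr_def)
  obtain e where e: "e \<in> Hom D (omap F X) (omap F ?GX)"
    "\<epsilon> (omap F X) \<cdot>\<^bsub>D\<^esub> e = Ident D (omap F X)"
    by (rule D.is_isoE[OF natural_isoD(2)[OF \<epsilon> FX] \<epsilon>X])
  have nat: "\<epsilon> (omap F Y) \<cdot>\<^bsub>D\<^esub> amap F (amap G h) = h \<cdot>\<^bsub>D\<^esub> \<epsilon> (omap F X)"
    if "h \<in> Hom D (omap F X) (omap F Y)" for h
    using natural_isoD(3)[OF \<epsilon> that] by (simp add: id_fctr_def comp_fctr_def)
  have cancel: "(h \<cdot>\<^bsub>D\<^esub> \<epsilon> (omap F X)) \<cdot>\<^bsub>D\<^esub> e = h" if h: "h \<in> Hom D (omap F X) (omap F Y)" for h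
    using D.Comp_assoc[OF e(1) \<epsilon>X h] e(2) D.Comp_Ident[OF h] by simp
  have "amap F f = (amap F f \<cdot>\<^bsub>D\<^esub> \<epsilon> (omap F X)) \<cdot>\<^bsub>D\<^esub> e" by (rule cancel[OF Ff, symmetric])
  also have "\<dots> = (g \<cdot>\<^bsub>D\<^esub> \<epsilon> (omap F X)) \<cdot>\<^bsub>D\<^esub> e"
    by (simp only: nat[OF Ff, symmetric] nat[OF g, symmetric] GG)
  also have "\<dots> = g" by (rule cancel[OF g])
  finally have "amap F f = g" .
  then show ?thesis using f by blast
qed

lemma essentially_surjective:
  assumes "Y \<in> Obj D"
  shows "\<exists>X \<in> Obj C. \<exists>e \<in> Hom D (omap F X) Y. is_iso D e"
proof -
  obtain G \<epsilon> where G: "is_functor D C G" and \<epsilon>: "natural_iso D D (comp_fctr F G) id_fctr \<epsilon>"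
    using equivalence unfolding is_equivalence_def by blast
  have "\<epsilon> Y \<in> Hom D (omap F (omap G Y)) Y" "is_iso D (\<epsilon> Y)"
    using natural_isoD[OF \<epsilon>] assms by (simp_all add: id_fctr_def comp_fctr_def)
  then show ?thesis using is_functorD(1)[OF G assms] by blast
qed

end

section \<open>Triangles\<close>

lemma (in additive_category) zero_object_iff:
  assumes "Z \<in> Obj C"
  shows "zero_object C Z \<longleftrightarrow> Ident C Z = Zero C Z Z"
proof
  assume "zero_object C Z"
  then have "Hom C Z Z = {Zero C Z Z}" using assms by (simp add: zero_object_def)
  then show "Ident C Z = Zero C Z Z" using Ident_closed[OF assms] by blast
next
  assume id0: "Ident C Z = Zero C Z Z"
  have "f = Zero C X Z" if "f \<in> Hom C X Z" for f X
    using Ident_Comp[OF that] Zero_Comp[OF that assms] id0 by simp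
  moreover have "f = Zero C Z X" if "f \<in> Hom C Z X" for f X
    using Comp_Ident[OF that] Comp_Zero[OF that assms] id0 by simp
  ultimately show "zero_object C Z"
    unfolding zero_object_def using Zero_closed assms by blast
qed

lemma (in additive_category) zero_object_exists: "\<exists>Z. zero_object C Z"
proof -
  obtain S i p where s: "is_direct_sum C 0 (\<lambda>_. undefined) S i p"
    using direct_sums[of 0 "\<lambda>_. undefined"] by blast
  then have S: "S \<in> Obj C" by (simp add: is_direct_sum_def)
  interpret abelian_group "hom_group C S S" by (rule hom_abelian_group[OF S S])
  have "Ident C S = Zero C S S" using s by (simp add: is_direct_sum_def)
  then show ?thesis using zero_object_iff[OF S] by blast
qed

context triangulated_category
begin

abbreviation susp :: "'o \<Rightarrow> 'o" where "susp \<equiv> omap (Susp C)"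
abbreviation smap :: "'m \<Rightarrow> 'm" where "smap \<equiv> amap (Susp C)"

sublocale susp: category_equivalence C C "Susp C"
  by unfold_locales (rule Susp_equivalence)

lemma susp_additive: "additive_functor C C (Susp C)"
  using Susp_linear by (simp add: linear_functor_def)

lemmas susp_closed = is_functorD(1)[OF susp.F_functor]
  and smap_closed = is_functorD(2)[OF susp.F_functor]
  and smap_Ident = is_functorD(3)[OF susp.F_functor]
  and smap_Comp = is_functorD(4)[OF susp.F_functor]
  and smap_Zero = additive_functor_Zero[OF preadditive_category_axioms preadditive_category_axioms
    susp_additive]

lemma smap_uminus:
  assumes "f \<in> Hom C X Y"
  shows "smap (\<ominus>\<^bsub>hom_group C X Y\<^esub> f) = \<ominus>\<^bsub>hom_group C (susp X) (susp Y)\<^esub> smap f"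
proof -
  have "X \<in> Obj C" "Y \<in> Obj C" using assms Hom_Obj by auto
  then show ?thesis
    using abelian_group_hom.hom_a_inv[OF additive_functor_hom[OF preadditive_category_axioms
        preadditive_category_axioms susp_additive], of X Y f] assms by simp
qed

lemma uminus_smap_surj:
  assumes "X \<in> Obj C" and "Y \<in> Obj C" and "g \<in> Hom C (susp X) (susp Y)"
  shows "\<exists>f \<in> Hom C X Y. \<ominus>\<^bsub>hom_group C (susp X) (susp Y)\<^esub> smap f = g"
proof -
  obtain f where f: "f \<in> Hom C X Y" "smap f = g" using susp.full[OF assms] by blast
  show ?thesis
    using smap_uminus[OF uminus_closed[OF f(1)]] uminus_uminus[OF f(1)]
      smap_uminus[OF f(1)] uminus_uminus[OF assms(3)] uminus_closed[OF f(1)] f(2)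
    by (intro bexI[of _ "\<ominus>\<^bsub>hom_group C X Y\<^esub> f"]) simp_all
qed

lemma uminus_inject:
  assumes "f \<in> Hom C X Y" and "g \<in> Hom C X Y"
    and "\<ominus>\<^bsub>hom_group C X Y\<^esub> f = \<ominus>\<^bsub>hom_group C X Y\<^esub> g"
  shows "f = g"
  using arg_cong[OF assms(3), of "a_inv (hom_group C X Y)"]
  by (simp only: uminus_uminus[OF assms(1)] uminus_uminus[OF assms(2)])

lemma Tri_third:
  assumes "(u, v, w) \<in> Tri C" and "u \<in> Hom C X Y" and "v \<in> Hom C Y Z"
  shows "w \<in> Hom C Z (susp X)"
proof -
  obtain X' Y' Z' where u: "u \<in> Hom C X' Y'" and v: "v \<in> Hom C Y' Z'" and w: "w \<in> Hom C Z' (susp X')"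
    using Tri_Hom[OF assms(1)] by blast
  show ?thesis using w Hom_disjoint[OF u assms(2)] Hom_disjoint[OF v assms(3)] by simp
qed

lemma rotate:
  assumes "(u, v, w) \<in> Tri C" and "u \<in> Hom C X Y" and "v \<in> Hom C Y Z"
  shows "(v, w, \<ominus>\<^bsub>hom_group C (susp X) (susp Y)\<^esub> smap u) \<in> Tri C"
  using TR2[OF assms(2,3) Tri_third[OF assms]] assms(1) by simp

lemma susp_zero_object:
  assumes "zero_object C Z"
  shows "zero_object C (susp Z)"
proof -
  have Z: "Z \<in> Obj C" using assms by (simp add: zero_object_def)
  show ?thesis
    using assms smap_Ident[OF Z] smap_Zero[OF Z Z]
    by (simp add: zero_object_iff[OF Z] zero_object_iff[OF susp_closed[OF Z]])
qed

lemma zero_object_Hom: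
  assumes "zero_object C Z"
  shows "f \<in> Hom C X Z \<Longrightarrow> f = Zero C X Z" and "f \<in> Hom C Z X \<Longrightarrow> f = Zero C Z X"
  using assms Hom_Obj unfolding zero_object_def by blast+

text \<open>Compare with the triangle on the identity of \<open>X\<close>.\<close>

lemma triangle_Comp_zero:
  assumes T: "(u, v, w) \<in> Tri C" and u: "u \<in> Hom C X Y" and v: "v \<in> Hom C Y Z"
  shows "v \<cdot> u = Zero C X Z"
proof -
  have XZ: "X \<in> Obj C" "Z \<in> Obj C" using u v Hom_Obj by auto
  obtain O0 where O0: "zero_object C O0" using zero_object_exists by blast
  then have OO: "O0 \<in> Obj C" by (simp add: zero_object_def)
  note z = Zero_closed[OF XZ(1) OO]
  obtain c where c: "c \<in> Hom C O0 Z" "c \<cdot> Zero C X O0 = v \<cdot> u"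
    using TR3[OF TR1_Ident[OF XZ(1) O0] T Ident_closed[OF XZ(1)] z u v Ident_closed[OF XZ(1)] u]
    by blast
  then show ?thesis using Comp_Zero[OF c(1) XZ(1)] by simp
qed

text \<open>Compare with the triangle \<open>0 \<rightarrow> W \<rightarrow> W\<close>.\<close>

lemma triangle_weak_cokernel:
  assumes T: "(u, v, w) \<in> Tri C" and u: "u \<in> Hom C X Y" and v: "v \<in> Hom C Y Z"
    and g: "g \<in> Hom C Y W" and gu: "g \<cdot> u = Zero C X W"
  shows "\<exists>h \<in> Hom C Z W. g = h \<cdot> v"
proof -
  have XW: "X \<in> Obj C" "W \<in> Obj C" using u g Hom_Obj by auto
  obtain O0 where O0: "zero_object C O0" using zero_object_exists by blast
  then have OO: "O0 \<in> Obj C" by (simp add: zero_object_def)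
  note sO = susp_zero_object[OF O0]
  have sOO: "susp O0 \<in> Obj C" by (rule susp_closed[OF OO])
  have sW: "susp W \<in> Obj C" by (rule susp_closed[OF XW(2)])
  note z1 = Zero_closed[OF OO XW(2)] and z2 = Zero_closed[OF XW(2) sOO]
  have "\<ominus>\<^bsub>hom_group C (susp O0) (susp W)\<^esub> smap (Zero C O0 W) = Zero C (susp O0) (susp W)"
    by (rule zero_object_Hom(2)[OF sO uminus_closed[OF smap_closed[OF z1]]])
  then have T0: "(Zero C O0 W, Ident C W, Zero C W (susp O0)) \<in> Tri C"
    using TR2[OF z1 Ident_closed[OF XW(2)] z2] TR1_Ident[OF XW(2) sO] by simp
  have "g \<cdot> u = Zero C O0 W \<cdot> Zero C X O0" using gu Comp_Zero[OF z1 XW(1)] by simp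
  from TR3[OF T T0 u v z1 Ident_closed[OF XW(2)] Zero_closed[OF XW(1) OO] g this]
  obtain h where h: "h \<in> Hom C Z W" "h \<cdot> v = Ident C W \<cdot> g" by blast
  then show ?thesis using Ident_Comp[OF g] by (intro bexI[of _ h]) simp_all
qed

text \<open>Compare with the triangle \<open>W \<rightarrow> 0 \<rightarrow> \<Sigma> W\<close>. The third morphism obtained in this way lives on suspensions;
  fullness and faithfulness of the suspension bring it back.\<close>

lemma triangle_weak_kernel:
  assumes T: "(u, v, w) \<in> Tri C" and u: "u \<in> Hom C X Y" and v: "v \<in> Hom C Y Z"
    and x: "x \<in> Hom C W Y" and vx: "v \<cdot> x = Zero C W Z"
  shows "\<exists>t \<in> Hom C W X. x = u \<cdot> t"
proof -
  have O: "X \<in> Obj C" "Y \<in> Obj C" "Z \<in> Obj C" "W \<in> Obj C" using u v x Hom_Obj by auto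
  have w: "w \<in> Hom C Z (susp X)" by (rule Tri_third[OF T u v])
  obtain O0 where O0: "zero_object C O0" using zero_object_exists by blast
  then have OO: "O0 \<in> Obj C" by (simp add: zero_object_def)
  have sW: "susp W \<in> Obj C" by (rule susp_closed[OF O(4)])
  note z1 = Zero_closed[OF O(4) OO] and z2 = Zero_closed[OF OO sW]
  have T0: "(Zero C W O0, Zero C O0 (susp W),
      \<ominus>\<^bsub>hom_group C (susp W) (susp W)\<^esub> smap (Ident C W)) \<in> Tri C"
    by (rule rotate[OF TR1_Ident[OF O(4) O0] Ident_closed[OF O(4)] z1])
  have "Zero C O0 Z \<cdot> Zero C W O0 = v \<cdot> x"
    using vx Comp_Zero[OF Zero_closed[OF OO O(3)] O(4)] by simp
  from TR3[OF T0 rotate[OF T u v] z1 z2 v w x Zero_closed[OF OO O(3)] this]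
  obtain c where c: "c \<in> Hom C (susp W) (susp X)"
    and eq: "smap x \<cdot> (\<ominus>\<^bsub>hom_group C (susp W) (susp W)\<^esub> smap (Ident C W)) =
      (\<ominus>\<^bsub>hom_group C (susp X) (susp Y)\<^esub> smap u) \<cdot> c" by blast
  obtain t where t: "t \<in> Hom C W X" "smap t = c" using susp.full[OF O(4,1) c] by blast
  note sx = smap_closed[OF x] and su = smap_closed[OF u]
  have "\<ominus>\<^bsub>hom_group C (susp W) (susp Y)\<^esub> smap x =
      \<ominus>\<^bsub>hom_group C (susp W) (susp Y)\<^esub> (smap u \<cdot> c)"
    using eq Comp_uminus_right[OF Ident_closed[OF sW] sx] Comp_uminus_left[OF c su]
      smap_Ident[OF O(4)] Comp_Ident[OF sx] by simp
  then have "smap x = smap (u \<cdot> t)"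
    using uminus_inject[OF sx Comp_closed[OF c su]] smap_Comp[OF t(1) u] t(2) by simp
  then have "x = u \<cdot> t" by (rule susp.faithful[OF x Comp_closed[OF t(1) u]])
  then show ?thesis using t(1) by blast
qed

text \<open>The cone of \<open>v\<close> is isomorphic to a suspension \<open>\<Sigma> X\<close>, so its triangle can be rotated backwards; the sign
  in the rotation axiom is absorbed into \<open>u\<close>.\<close>

lemma triangle_on_second:
  assumes v: "v \<in> Hom C Y Z"
  shows "\<exists>X u w. u \<in> Hom C X Y \<and> w \<in> Hom C Z (susp X) \<and> (u, v, w) \<in> Tri C"
proof -
  have O: "Y \<in> Obj C" "Z \<in> Obj C" using v Hom_Obj by auto
  obtain a b where T: "(v, a, b) \<in> Tri C" using TR1_cone[OF v] by blast
  obtain M where a: "a \<in> Hom C Z M"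
    using Tri_Hom[OF T] Hom_disjoint[OF v] by blast
  have b: "b \<in> Hom C M (susp Y)" by (rule Tri_third[OF T v a])
  have MO: "M \<in> Obj C" using a Hom_Obj by auto
  obtain X e where X: "X \<in> Obj C" and e: "e \<in> Hom C (susp X) M" and iso: "is_iso C e"
    using susp.essentially_surjective[OF MO] by blast
  obtain e' where e': "e' \<in> Hom C M (susp X)" "e' \<cdot> e = Ident C (susp X)" "e \<cdot> e' = Ident C M"
    by (rule is_isoE[OF iso e])
  have iso': "is_iso C e'" unfolding is_iso_def using e e' by blast
  have id_iso: "is_iso C (Ident C A)" if "A \<in> Obj C" for A
    unfolding is_iso_def using Ident_closed[OF that] Ident_Comp[OF Ident_closed[OF that]] by blast
  note w = Comp_closed[OF a e'(1)] and be = Comp_closed[OF e b]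
  have "(v, e' \<cdot> a, b \<cdot> e) \<in> Tri C"
  proof (rule TR1_iso[OF T v a b v w be Ident_closed[OF O(1)] Ident_closed[OF O(2)] e'(1)
        id_iso[OF O(1)] id_iso[OF O(2)] iso'])
    show "Ident C Z \<cdot> v = v \<cdot> Ident C Y" using Ident_Comp[OF v] Comp_Ident[OF v] by simp
    show "e' \<cdot> a = (e' \<cdot> a) \<cdot> Ident C Z" using Comp_Ident[OF w] by simp
    show "smap (Ident C Y) \<cdot> b = (b \<cdot> e) \<cdot> e'"
      using smap_Ident[OF O(1)] Ident_Comp[OF b] Comp_assoc[OF e'(1) e b] e'(3) Comp_Ident[OF b]
      by simp
  qed
  moreover obtain u where u: "u \<in> Hom C X Y"
    and su: "\<ominus>\<^bsub>hom_group C (susp X) (susp Y)\<^esub> smap u = b \<cdot> e"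
    using uminus_smap_surj[OF X O(1) be] by blast
  ultimately have "(u, v, e' \<cdot> a) \<in> Tri C" using TR2[OF u v w] by simp
  then show ?thesis using u w by blast
qed

lemma triangle_on_third:
  assumes w: "w \<in> Hom C Z (susp X)" and X: "X \<in> Obj C"
  shows "\<exists>Y u v. u \<in> Hom C X Y \<and> v \<in> Hom C Y Z \<and> (u, v, w) \<in> Tri C"
proof -
  obtain Y v x where v: "v \<in> Hom C Y Z" and x: "x \<in> Hom C (susp X) (susp Y)" and T: "(v, w, x) \<in> Tri C"
    using triangle_on_second[OF w] by blast
  have Y: "Y \<in> Obj C" using v Hom_Obj by auto
  obtain u where u: "u \<in> Hom C X Y" and su: "\<ominus>\<^bsub>hom_group C (susp X) (susp Y)\<^esub> smap u = x"
    using uminus_smap_surj[OF X Y x] by blast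
  have "(u, v, w) \<in> Tri C" using TR2[OF u v w] T su by simp
  then show ?thesis using u v by blast
qed

text \<open>The axiom for morphisms of triangles, applied after two rotations. This yields a morphism between
  suspensions, which is the suspension of the required one.\<close>

lemma triangle_fill_middle:
  assumes T: "(u, v, w) \<in> Tri C" and u: "u \<in> Hom C X Y" and v: "v \<in> Hom C Y Z"
    and T': "(u', v', w') \<in> Tri C" and u': "u' \<in> Hom C X' Y'" and v': "v' \<in> Hom C Y' Z'"
    and a: "a \<in> Hom C X X'" and c: "c \<in> Hom C Z Z'" and eq: "smap a \<cdot> w = w' \<cdot> c"
  shows "\<exists>b \<in> Hom C Y Y'. b \<cdot> u = u' \<cdot> a \<and> c \<cdot> v = v' \<cdot> b"
proof -
  have O: "Y \<in> Obj C" "Y' \<in> Obj C" using u u' Hom_Obj by auto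
  have w: "w \<in> Hom C Z (susp X)" and w': "w' \<in> Hom C Z' (susp X')"
    by (rule Tri_third[OF T u v], rule Tri_third[OF T' u' v'])
  note su = smap_closed[OF u] and su' = smap_closed[OF u'] and sv = smap_closed[OF v]
    and sv' = smap_closed[OF v'] and sa = smap_closed[OF a] and sc = smap_closed[OF c]
  note T1 = rotate[OF T u v] and T1' = rotate[OF T' u' v']
  note T2 = rotate[OF T1 v w] and T2' = rotate[OF T1' v' w']
  from TR3[OF T2 T2' w uminus_closed[OF su] w' uminus_closed[OF su'] c sa eq]
  obtain d where d: "d \<in> Hom C (susp Y) (susp Y')"
    and d1: "d \<cdot> (\<ominus>\<^bsub>hom_group C (susp X) (susp Y)\<^esub> smap u) =
      (\<ominus>\<^bsub>hom_group C (susp X') (susp Y')\<^esub> smap u') \<cdot> smap a"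
    and d2: "smap c \<cdot> (\<ominus>\<^bsub>hom_group C (susp Y) (susp Z)\<^esub> smap v) =
      (\<ominus>\<^bsub>hom_group C (susp Y') (susp Z')\<^esub> smap v') \<cdot> d" by blast
  obtain b where b: "b \<in> Hom C Y Y'" "smap b = d" using susp.full[OF O d] by blast
  have "d \<cdot> smap u = smap u' \<cdot> smap a"
    using d1 Comp_uminus_right[OF su d] Comp_uminus_left[OF sa su']
      uminus_inject[OF Comp_closed[OF su d] Comp_closed[OF sa su']] by simp
  then have 1: "b \<cdot> u = u' \<cdot> a"
    using smap_Comp[OF u b(1)] smap_Comp[OF a u'] b(2)
    by (intro susp.faithful[OF Comp_closed[OF u b(1)] Comp_closed[OF a u']]) simp
  have "smap c \<cdot> smap v = smap v' \<cdot> d"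
    using d2 Comp_uminus_right[OF sv sc] Comp_uminus_left[OF d sv']
      uminus_inject[OF Comp_closed[OF sv sc] Comp_closed[OF d sv']] by simp
  then have 2: "c \<cdot> v = v' \<cdot> b"
    using smap_Comp[OF v c] smap_Comp[OF b(1) v'] b(2)
    by (intro susp.faithful[OF Comp_closed[OF v c] Comp_closed[OF b(1) v']]) simp
  show ?thesis using b(1) 1 2 by blast
qed

end

section \<open>Triangles on a rigid object\<close>

lemma (in preadditive_category) Hom_copies_zero:
  assumes E: "E \<in> copies C N" and Y: "Y \<in> Obj C"
  shows "Hom C N Y = {Zero C N Y} \<Longrightarrow> Hom C E Y = {Zero C E Y}"
    and "Hom C Y N = {Zero C Y N} \<Longrightarrow> Hom C Y E = {Zero C Y E}"
proof -
  have EO: "E \<in> Obj C" by (rule copies_Obj[OF E])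
  assume 0: "Hom C N Y = {Zero C N Y}"
  have "f = Zero C E Y" if f: "f \<in> Hom C E Y" for f
  proof (rule copies_ext[OF E f Zero_closed[OF EO Y]])
    fix x assume x: "x \<in> Hom C N E"
    show "f \<cdot> x = Zero C E Y \<cdot> x" using Comp_closed[OF x f] Zero_Comp[OF x Y] 0 by simp
  qed
  then show "Hom C E Y = {Zero C E Y}" using Zero_closed[OF EO Y] by blast
next
  have EO: "E \<in> Obj C" by (rule copies_Obj[OF E])
  assume 0: "Hom C Y N = {Zero C Y N}"
  obtain n i p where s: "is_direct_sum C n (\<lambda>_. N) E i p" using E by (auto simp: copies_def)
  have "f = Zero C Y E" if f: "f \<in> Hom C Y E" for f
  proof (rule direct_sum_ext_right[OF s f Zero_closed[OF Y EO]])
    fix j assume "j < n"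
    then have p: "p j \<in> Hom C E N" using s by (simp add: is_direct_sum_def)
    show "p j \<cdot> f = p j \<cdot> Zero C Y E" using Comp_closed[OF f p] Comp_Zero[OF p Y] 0 by simp
  qed
  then show "Hom C Y E = {Zero C Y E}" using Zero_closed[OF Y EO] by blast
qed

context triangulated_category
begin

definition cones_from :: "'o \<Rightarrow> ('m \<times> 'm) set" where
  "cones_from R = {(r, c). \<exists>w E B. (r, c, w) \<in> Tri C \<and> r \<in> Hom C E B \<and> E \<in> copies C R}"

definition cocones_to :: "'o \<Rightarrow> ('m \<times> 'm) set" where
  "cocones_to N = {(n, k). \<exists>w B E. (k, n, w) \<in> Tri C \<and> n \<in> Hom C B E \<and> E \<in> copies C N}"

lemma cones_fromE:
  assumes "(r, c) \<in> cones_from R" and "r \<in> Hom C E B"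
  obtains w where "(r, c, w) \<in> Tri C" and "E \<in> copies C R"
proof -
  obtain w E' B' where T: "(r, c, w) \<in> Tri C" and r: "r \<in> Hom C E' B'" and E: "E' \<in> copies C R"
    using assms(1) by (auto simp: cones_from_def)
  have "E' = E" using Hom_disjoint[OF r assms(2)] by simp
  then show thesis using that[OF T] E by simp
qed

lemma cocones_toE:
  assumes "(n, k) \<in> cocones_to N" and "n \<in> Hom C B E"
  obtains w where "(k, n, w) \<in> Tri C" and "E \<in> copies C N"
proof -
  obtain w E' B' where T: "(k, n, w) \<in> Tri C" and n: "n \<in> Hom C B' E'" and E: "E' \<in> copies C N"
    using assms(1) by (auto simp: cocones_to_def)
  have "E' = E" using Hom_disjoint[OF n assms(2)] by simp
  then show thesis using that[OF T] E by simp
qed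

text \<open>Lifting: with \<open>Hom(R, \<Sigma> R)\<close> also \<open>Hom(R, \<Sigma> E)\<close> vanishes, as \<open>\<Sigma> E\<close> is a sum of copies of \<open>\<Sigma> R\<close>. Base change:
  the triangle over \<open>Y\<close> is the one that ends in the composite \<open>Y \<rightarrow> D \<rightarrow> \<Sigma> E\<close>.\<close>

lemma rigid_cones_from:
  assumes fin: "hom_finite K C" and rigid: "rigid C R"
  shows "rigid_cones C R (cones_from R)"
proof (intro rigid_cones.intro additive_category_axioms rigid_cones_axioms.intro)
  show RO: "R \<in> Obj C" using rigid by (simp add: rigid_def)
  show "\<exists>E \<in> copies C R. \<exists>r \<in> Hom C E A. \<forall>x \<in> Hom C R A. \<exists>t \<in> Hom C R E. x = r \<cdot> t"
    if "A \<in> Obj C" for A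
    by (rule right_approximation[OF fin RO that])
  show "\<exists>D. \<exists>c \<in> Hom C B D. (r, c) \<in> cones_from R"
    if E: "E \<in> copies C R" and r: "r \<in> Hom C E B" for E r B
  proof -
    obtain c w where T: "(r, c, w) \<in> Tri C" using TR1_cone[OF r] by blast
    obtain D where "c \<in> Hom C B D" using Tri_Hom[OF T] Hom_disjoint[OF r] by blast
    then show ?thesis using T r E by (auto simp: cones_from_def)
  qed
  fix r c E B assume rc: "(r, c) \<in> cones_from R" and r: "r \<in> Hom C E B"
  obtain w where T: "(r, c, w) \<in> Tri C" and E: "E \<in> copies C R" by (rule cones_fromE[OF rc r])
  show "E \<in> copies C R" by (rule E)
  fix D assume c: "c \<in> Hom C B D"
  have w: "w \<in> Hom C D (susp E)" by (rule Tri_third[OF T r c])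
  have EO: "E \<in> Obj C" by (rule copies_Obj[OF E])
  show "c \<cdot> r = Zero C E D" by (rule triangle_Comp_zero[OF T r c])
  show "\<exists>h \<in> Hom C D W. g = h \<cdot> c" if "g \<in> Hom C B W" "g \<cdot> r = Zero C E W" for g W
    by (rule triangle_weak_cokernel[OF T r c that])
  show "\<exists>t \<in> Hom C R E. x = r \<cdot> t" if "x \<in> Hom C R B" "c \<cdot> x = Zero C R D" for x
    by (rule triangle_weak_kernel[OF T r c that])
  show "\<exists>y \<in> Hom C R B. x = c \<cdot> y" if x: "x \<in> Hom C R D" for x
  proof (rule triangle_weak_kernel[OF rotate[OF T r c] c w x])
    have "Hom C R (susp R) = {Zero C R (susp R)}" using rigid by (simp add: rigid_def Ext1_def)
    moreover obtain n i p where s: "is_direct_sum C n (\<lambda>_. R) E i p"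
      using E by (auto simp: copies_def)
    have "susp E \<in> copies C (susp R)"
      using additive_functor_direct_sum[OF preadditive_category_axioms preadditive_category_axioms
          susp_additive s] unfolding copies_def by blast
    ultimately have "Hom C R (susp E) = {Zero C R (susp E)}" using Hom_copies_zero(2)[OF _ RO] by blast
    then show "w \<cdot> x = Zero C R (susp E)" using Comp_closed[OF x w] by blast
  qed
  show "\<exists>P. \<exists>r' \<in> Hom C E P. \<exists>c' \<in> Hom C P Y. \<exists>b \<in> Hom C P B.
      (r', c') \<in> cones_from R \<and> b \<cdot> r' = r \<and> c \<cdot> b = g \<cdot> c'"
    if g: "g \<in> Hom C Y D" for g Y
  proof -
    obtain P r' c' where r': "r' \<in> Hom C E P" and c': "c' \<in> Hom C P Y" and T': "(r', c', w \<cdot> g) \<in> Tri C"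
      using triangle_on_third[OF Comp_closed[OF g w] EO] by blast
    have "smap (Ident C E) \<cdot> (w \<cdot> g) = w \<cdot> g"
      using smap_Ident[OF EO] Ident_Comp[OF Comp_closed[OF g w]] by simp
    from triangle_fill_middle[OF T' r' c' T r c Ident_closed[OF EO] g this]
    obtain b where b: "b \<in> Hom C P B" and 1: "b \<cdot> r' = r \<cdot> Ident C E" and 2: "g \<cdot> c' = c \<cdot> b" by blast
    have "(r', c') \<in> cones_from R" using T' r' E by (auto simp: cones_from_def)
    then show ?thesis using r' c' b 1 2 Comp_Ident[OF r] by metis
  qed
qed

text \<open>The dual statement. A morphism \<open>x : D \<rightarrow> N\<close> extends along \<open>k : D \<rightarrow> B\<close> because the composite of \<open>\<Sigma> x\<close> with
  \<open>E \<rightarrow> \<Sigma> D\<close> lies in \<open>Hom(E, \<Sigma> N) = 0\<close>. The pushout of the triangle \<open>D \<rightarrow> B \<rightarrow> E\<close> along \<open>g : D \<rightarrow> Y\<close> is the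
  triangle that ends in \<open>E \<rightarrow> \<Sigma> D \<rightarrow> \<Sigma> Y\<close>.\<close>

lemma rigid_cocones_to:
  assumes fin: "hom_finite K C" and rigid: "rigid C N"
  shows "rigid_cones (op_cat C) N (cocones_to N)"
proof (intro rigid_cones.intro additive_category_op additive_category_axioms rigid_cones_axioms.intro;
    simp only: op_cat_simps copies_op)
  show NO: "N \<in> Obj C" using rigid by (simp add: rigid_def)
  show "\<exists>E \<in> copies C N. \<exists>r \<in> Hom C A E. \<forall>x \<in> Hom C A N. \<exists>t \<in> Hom C E N. x = t \<cdot> r"
    if "A \<in> Obj C" for A
    by (rule left_approximation[OF fin NO that])
  show "\<exists>D. \<exists>k \<in> Hom C D B. (n, k) \<in> cocones_to N"
    if E: "E \<in> copies C N" and n: "n \<in> Hom C B E" for E n B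
    using triangle_on_second[OF n] n E unfolding cocones_to_def by blast
  fix n k E B assume nk: "(n, k) \<in> cocones_to N" and n: "n \<in> Hom C B E"
  obtain w where T: "(k, n, w) \<in> Tri C" and E: "E \<in> copies C N" by (rule cocones_toE[OF nk n])
  show "E \<in> copies C N" by (rule E)
  fix D assume k: "k \<in> Hom C D B"
  have w: "w \<in> Hom C E (susp D)" by (rule Tri_third[OF T k n])
  have DO: "D \<in> Obj C" and BO: "B \<in> Obj C" and EO: "E \<in> Obj C" using k n Hom_Obj by auto
  show "n \<cdot> k = Zero C D E" by (rule triangle_Comp_zero[OF T k n])
  show "\<exists>h \<in> Hom C W D. g = k \<cdot> h" if "g \<in> Hom C W B" "n \<cdot> g = Zero C W E" for g W
    by (rule triangle_weak_kernel[OF T k n that])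
  show "\<exists>t \<in> Hom C E N. x = t \<cdot> n" if "x \<in> Hom C B N" "x \<cdot> k = Zero C D N" for x
    by (rule triangle_weak_cokernel[OF T k n that])
  show "\<exists>y \<in> Hom C B N. x = y \<cdot> k" if x: "x \<in> Hom C D N" for x
  proof -
    note sx = smap_closed[OF x] and sk = smap_closed[OF k]
    have "Hom C N (susp N) = {Zero C N (susp N)}" using rigid by (simp add: rigid_def Ext1_def)
    then have "Hom C E (susp N) = {Zero C E (susp N)}"
      by (rule Hom_copies_zero(1)[OF E susp_closed[OF NO]])
    then have "smap x \<cdot> w = Zero C E (susp N)" using Comp_closed[OF w sx] by blast
    from triangle_weak_cokernel[OF rotate[OF rotate[OF T k n] n w] w uminus_closed[OF sk] sx this]
    obtain y where y: "y \<in> Hom C (susp B) (susp N)"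
      and eq: "smap x = y \<cdot> (\<ominus>\<^bsub>hom_group C (susp D) (susp B)\<^esub> smap k)" by blast
    obtain z where z: "z \<in> Hom C B N" "\<ominus>\<^bsub>hom_group C (susp B) (susp N)\<^esub> smap z = y"
      using uminus_smap_surj[OF BO NO y] by blast
    note sz = smap_closed[OF z(1)]
    have "smap x = \<ominus>\<^bsub>hom_group C (susp D) (susp N)\<^esub> (y \<cdot> smap k)"
      using eq Comp_uminus_right[OF sk y] by simp
    also have "y \<cdot> smap k = \<ominus>\<^bsub>hom_group C (susp D) (susp N)\<^esub> (smap z \<cdot> smap k)"
      using Comp_uminus_left[OF sk sz] z(2) by simp
    also have "\<ominus>\<^bsub>hom_group C (susp D) (susp N)\<^esub> \<dots> = smap z \<cdot> smap k"
      by (rule uminus_uminus[OF Comp_closed[OF sk sz]])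
    also have "\<dots> = smap (z \<cdot> k)" using smap_Comp[OF k z(1)] by simp
    finally have "x = z \<cdot> k" by (rule susp.faithful[OF x Comp_closed[OF k z(1)]])
    then show ?thesis using z(1) by blast
  qed
  show "\<exists>P. \<exists>n' \<in> Hom C P E. \<exists>k' \<in> Hom C Y P. \<exists>b \<in> Hom C B P.
      (n', k') \<in> cocones_to N \<and> n' \<cdot> b = n \<and> b \<cdot> k = k' \<cdot> g"
    if g: "g \<in> Hom C D Y" for g Y
  proof -
    have YO: "Y \<in> Obj C" using g Hom_Obj by auto
    obtain P k' n' where k': "k' \<in> Hom C Y P" and n': "n' \<in> Hom C P E"
      and T': "(k', n', smap g \<cdot> w) \<in> Tri C"
      using triangle_on_third[OF Comp_closed[OF w smap_closed[OF g]] YO] by blast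
    have "smap g \<cdot> w = (smap g \<cdot> w) \<cdot> Ident C E"
      using Comp_Ident[OF Comp_closed[OF w smap_closed[OF g]]] by simp
    from triangle_fill_middle[OF T k n T' k' n' g Ident_closed[OF EO] this]
    obtain b where b: "b \<in> Hom C B P" and 1: "b \<cdot> k = k' \<cdot> g" and 2: "Ident C E \<cdot> n = n' \<cdot> b" by blast
    have "(n', k') \<in> cocones_to N" using T' n' E by (auto simp: cocones_to_def)
    then show ?thesis using k' n' b 1 2 Ident_Comp[OF n] by metis
  qed
qed

end

section \<open>Serre duality\<close>

lemma dual_of_zero_space:
  fixes K :: "('k, 'r) ring_scheme" and V :: "('k, 'v, 'z) module_scheme"
  assumes "vectorspace K V" and zero: "carrier V = {\<zero>\<^bsub>V\<^esub>}"
    and f: "f \<in> carrier (dual_space K V)" and g: "g \<in> carrier (dual_space K V)"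
  shows "f = g"
proof -
  interpret V: vectorspace K V by fact
  have at_zero: "h \<zero>\<^bsub>V\<^esub> = \<zero>\<^bsub>K\<^esub>" if h: "h \<in> carrier (dual_space K V)" for h
  proof -
    have hom: "h \<in> module_hom K V (scalar_module K)" using h by (simp add: dual_space_def)
    then have "h \<zero>\<^bsub>V\<^esub> \<in> carrier K"
      by (auto simp: module_hom_def scalar_module_def zero)
    moreover have "\<forall>c v. c \<in> carrier K \<and> v \<in> carrier V \<longrightarrow> h (c \<odot>\<^bsub>V\<^esub> v) = c \<otimes>\<^bsub>K\<^esub> h v"
      using hom by (simp add: module_hom_def scalar_module_def)
    then have "h (\<zero>\<^bsub>K\<^esub> \<odot>\<^bsub>V\<^esub> \<zero>\<^bsub>V\<^esub>) = \<zero>\<^bsub>K\<^esub> \<otimes>\<^bsub>K\<^esub> h \<zero>\<^bsub>V\<^esub>" by blast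
    moreover have "\<zero>\<^bsub>K\<^esub> \<odot>\<^bsub>V\<^esub> \<zero>\<^bsub>V\<^esub> = \<zero>\<^bsub>V\<^esub>" by (simp add: V.smult_l_null)
    ultimately show ?thesis by simp
  qed
  show ?thesis
  proof (rule extensionalityI)
    show "f \<in> extensional {\<zero>\<^bsub>V\<^esub>}" "g \<in> extensional {\<zero>\<^bsub>V\<^esub>}"
      using f g by (simp_all add: dual_space_def zero)
    show "f x = g x" if "x \<in> {\<zero>\<^bsub>V\<^esub>}" for x using that at_zero[OF f] at_zero[OF g] by simp
  qed
qed

locale serre_category = triangulated_category K C
  for K :: "('k, 'r) ring_scheme" and C :: "('o, 'm, 'k, 'z) tricat_scheme" (structure) +
  fixes \<nu> :: "('o, 'm, 'o, 'm) fctr"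
  assumes serre: "serre_functor K C \<nu>"
begin

sublocale nu: category_equivalence C C \<nu>
  using serre by unfold_locales (simp add: serre_functor_def)

text \<open>\<open>Hom C X Y\<close> is in bijection with the dual of a zero space.\<close>

lemma Hom_zero_if_nu:
  assumes XY: "X \<in> Obj C" "Y \<in> Obj C" and 0: "Hom C Y (omap \<nu> X) = {Zero C Y (omap \<nu> X)}"
  shows "Hom C X Y = {Zero C X Y}"
proof -
  let ?V = "hom_module C Y (omap \<nu> X)"
  obtain \<phi> where "bij_betw (\<phi> X Y) (Hom C X Y) (carrier (dual_space K ?V))"
    using serre XY unfolding serre_functor_def by blast
  then have inj: "inj_on (\<phi> X Y) (Hom C X Y)" and im: "\<phi> X Y ` Hom C X Y = carrier (dual_space K ?V)"
    by (auto simp: bij_betw_def)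
  have vs: "vectorspace K ?V" by (rule hom_vectorspace[OF XY(2) is_functorD(1)[OF nu.F_functor XY(1)]])
  have V0: "carrier ?V = {\<zero>\<^bsub>?V\<^esub>}" using 0 by (simp add: hom_module_def)
  note z = Zero_closed[OF XY]
  have "f = Zero C X Y" if f: "f \<in> Hom C X Y" for f
  proof (rule inj_onD[OF inj _ f z])
    show "\<phi> X Y f = \<phi> X Y (Zero C X Y)"
      by (rule dual_of_zero_space[OF vs V0]) (use im f z in blast)+
  qed
  then show ?thesis using z by blast
qed

lemma nu_additive: "additive_functor C C \<nu>"
  using serre by (simp add: serre_functor_def triangle_functor_def)

lemma Hom_zero_nu:
  assumes XY: "X \<in> Obj C" "Y \<in> Obj C" and 0: "Hom C X Y = {Zero C X Y}"
  shows "Hom C (omap \<nu> X) (omap \<nu> Y) = {Zero C (omap \<nu> X) (omap \<nu> Y)}"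
proof -
  have "g = Zero C (omap \<nu> X) (omap \<nu> Y)" if g: "g \<in> Hom C (omap \<nu> X) (omap \<nu> Y)" for g
  proof -
    obtain f where "f \<in> Hom C X Y" "amap \<nu> f = g" using nu.full[OF XY g] by blast
    then show ?thesis
      using 0 additive_functor_Zero[OF preadditive_category_axioms preadditive_category_axioms
          nu_additive XY] by simp
  qed
  then show ?thesis
    using Zero_closed[OF is_functorD(1)[OF nu.F_functor XY(1)] is_functorD(1)[OF nu.F_functor XY(2)]]
    by blast
qed

text \<open>Each implication is one use of Serre duality. If \<open>Hom(R, Y) = 0\<close> then \<open>Hom(\<nu> R, \<nu> Y) = 0\<close>, because \<open>\<nu>\<close> is
  full, and \<open>Hom(Y, \<nu> R)\<close> is its dual. Arguing with this second duality, instead of inverting the first,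
  avoids functionals that separate points.\<close>

lemma perp_objects_op:
  assumes R: "R \<in> Obj C"
  shows "perp_objects (op_cat C) (omap \<nu> R) = perp_objects C R"
proof -
  have nR: "omap \<nu> R \<in> Obj C" by (rule is_functorD(1)[OF nu.F_functor R])
  have "Hom C Y (omap \<nu> R) = {Zero C Y (omap \<nu> R)} \<longleftrightarrow> Hom C R Y = {Zero C R Y}"
    if Y: "Y \<in> Obj C" for Y
    using Hom_zero_if_nu[OF R Y] Hom_zero_if_nu[OF Y nR Hom_zero_nu[OF R Y]] by blast
  then show ?thesis by (auto simp: perp_objects_def)
qed

text \<open>\<open>Hom(\<nu> R, \<Sigma> (\<nu> R))\<close> is isomorphic to \<open>Hom(\<nu> R, \<nu> (\<Sigma> R))\<close>, hence to \<open>Hom(R, \<Sigma> R)\<close>.\<close>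

lemma rigid_nu:
  assumes rigid: "rigid C R"
  shows "rigid C (omap \<nu> R)"
proof -
  have R: "R \<in> Obj C" and 0: "Hom C R (susp R) = {Zero C R (susp R)}"
    using rigid by (auto simp: rigid_def Ext1_def)
  let ?N = "omap \<nu> R" and ?M = "omap \<nu> (susp R)"
  have N: "?N \<in> Obj C" by (rule is_functorD(1)[OF nu.F_functor R])
  obtain \<theta> where \<theta>: "natural_iso C C (comp_fctr \<nu> (Susp C)) (comp_fctr (Susp C) \<nu>) \<theta>"
    using serre unfolding serre_functor_def triangle_functor_def by blast
  have \<theta>R: "\<theta> R \<in> Hom C ?M (susp ?N)" using natural_isoD(1)[OF \<theta> R] by (simp add: comp_fctr_def)
  obtain u where u: "u \<in> Hom C (susp ?N) ?M" "\<theta> R \<cdot> u = Ident C (susp ?N)"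
    by (rule is_isoE[OF natural_isoD(2)[OF \<theta> R] \<theta>R])
  have M0: "Hom C ?N ?M = {Zero C ?N ?M}" by (rule Hom_zero_nu[OF R susp_closed[OF R] 0])
  have "x = Zero C ?N (susp ?N)" if x: "x \<in> Hom C ?N (susp ?N)" for x
  proof -
    have "u \<cdot> x = Zero C ?N ?M" using Comp_closed[OF x u(1)] M0 by blast
    then show ?thesis
      using Comp_assoc[OF x u(1) \<theta>R] u(2) Ident_Comp[OF x] Comp_Zero[OF \<theta>R N] by simp
  qed
  then show ?thesis
    using N Zero_closed[OF N susp_closed[OF N]] unfolding rigid_def Ext1_def by blast
qed

end

section \<open>The quotient is quasi-abelian\<close>

lemma is_cokernel_op: "is_cokernel (op_cat D) f k \<longleftrightarrow> is_kernel D f k"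
  unfolding is_cokernel_def is_kernel_def op_cat_simps
  by (intro iffI; elim exE; intro exI; assumption)

lemma is_pullback_op: "is_pullback (op_cat D) f g p q \<longleftrightarrow> is_pushout D f g p q"
  unfolding is_pullback_def is_pushout_def op_cat_simps
  by (intro iffI; elim exE; intro exI; assumption)

theorem theorem5p5:
  fixes K :: "('k, 'r) ring_scheme"
    and C :: "('o, 'm, 'k, 'z) tricat_scheme"
    and R :: "'o"
  assumes "field K"
    and "triangulated_category K C"
    and "hom_finite K C"
    and "krull_schmidt C"
    and "has_serre_duality K C"
    and "rigid C R"
  shows "quasi_abelian_category (quotient_category C (perp_objects C R))"
proof -
  interpret triangulated_category K C by fact
  obtain \<nu> where \<nu>: "serre_functor K C \<nu>" using assms(5) by (auto simp: has_serre_duality_def)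
  interpret serre_category K C \<nu> by unfold_locales (rule \<nu>)
  interpret right: rigid_cones C R "cones_from R"
    by (rule rigid_cones_from[OF assms(3,6)])
  interpret left: rigid_cones "op_cat C" "omap \<nu> R" "cocones_to (omap \<nu> R)"
    by (rule rigid_cocones_to[OF assms(3) rigid_nu[OF assms(6)]])
  let ?Q = "quotient_category C (perp_objects C R)"
  have op: "quotient_category (op_cat C) (perp_objects (op_cat C) (omap \<nu> R)) = op_cat ?Q"
    by (simp only: quotient_category_op perp_objects_op[OF right.R_in_Obj])
  show ?thesis
  proof (intro quasi_abelian_category.intro preabelian_category.intro right.additive_Q
      preabelian_category_axioms.intro quasi_abelian_category_axioms.intro)
    fix f X Y assume f: "f \<in> Hom ?Q X Y"
    show "\<exists>c. is_cokernel ?Q f c" by (rule right.cokernel_is_cone[OF f]) blast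
    have "f \<in> Hom (op_cat ?Q) Y X" using f by simp
    from left.cokernel_is_cone[unfolded op, OF this]
    show "\<exists>k. is_kernel ?Q f k" unfolding is_cokernel_op by blast
  next
    fix f g p q assume "is_pullback ?Q f g p q" and "\<exists>h. is_cokernel ?Q h f"
    then show "\<exists>h. is_cokernel ?Q h q" using right.cokernels_pullback_stable by blast
  next
    fix f g i j assume "is_pushout ?Q f g i j" and "\<exists>h. is_kernel ?Q h f"
    then show "\<exists>h. is_kernel ?Q h j"
      using left.cokernels_pullback_stable[unfolded op is_cokernel_op is_pullback_op] by blast
  qed
qed

end
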